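(* Let $\varphi$ be a smooth positive function of the length. A smooth path $t\mapsto c(t,\cdot)$ in $Imm(S^1,\mathbb{R}^2)$ is a geodesic for the metric $G^\varphi$ on $Imm(S^1,\mathbb{R}^2)$ if and only if $$\left(\varphi(\ell)|c_\theta|c_t\right)_t=-\frac12\left[\left(\int_{S^1}|c_t|^2|c_\theta|\,d\theta\right)i\,\varphi'(\ell)\,\kappa_c\,c_\theta+\varphi(\ell)\left(\frac{|c_t|^2c_\theta}{|c_\theta|}\right)_\theta\right],$$ where $\varphi'=d\varphi/d\ell$ and $\ell=\ell(c(t,\cdot))$.
   Context: $Imm(S^1,\mathbb{R}^2)$ is the space of $C^\infty$ immersions $S^1\to\mathbb{R}^2$, and $\mathbb{R}^2$ is identified with $\mathbb{C}$. Subscripts $t,\theta$ denote partial derivatives; $\ell(c)=\int_{S^1}|c_\theta|\,d\theta$; $n_c=ic_\theta/|c_\theta|$ is the unit normal; the curvature $\kappa_c$ is defined by $\left(\frac{c_\theta}{|c_\theta|}\right)_\theta=i\kappa_cc_\theta=\kappa_c|c_\theta|n_c$. The metric is $$G^{\varphi}_c(h,k)=\varphi(\ell(c))\int_{S^1}(h\cdot k)\,|c_\theta|\,d\theta,\qquad h,k\in C^\infty(S^1,\mathbb{R}^2).$$ A path $c(t,\cdot)$, $a\le t\le b$, is a geodesic if it is a critical point of the energy $E_{G^\varphi}(c)=\frac12\int_a^b G^\varphi_c(c_t,c_t)\,dt$ with respect to smooth variations with fixed endpoints. *)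

theory Defs
  imports "HOL-Analysis.Analysis"
begin

(* Derivatives are taken within S, hence one-sided on the boundary. The notion is only
   meaningful for sets on which Frechet derivatives are unique; it is used below for open
   sets and for products of nondegenerate intervals. *)
primrec Ck_on :: "nat \<Rightarrow> ('a::euclidean_space \<Rightarrow> 'b::real_normed_vector) \<Rightarrow> 'a set \<Rightarrow> bool" where
  "Ck_on 0 f S \<longleftrightarrow> continuous_on S f"
| "Ck_on (Suc k) f S \<longleftrightarrow>
     f differentiable_on S \<and> (\<forall>v. Ck_on k (\<lambda>x. frechet_derivative f (at x within S) v) S)"

definition smooth_on :: "'a set \<Rightarrow> ('a::euclidean_space \<Rightarrow> 'b::real_normed_vector) \<Rightarrow> bool" where
  "smooth_on S f \<longleftrightarrow> (\<forall>k. Ck_on k f S)"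

(* Functions on the circle are 2*pi-periodic functions of the angle; the plane is the type complex. *)
definition Imm :: "(real \<Rightarrow> complex) set" where
  "Imm = {c. smooth_on UNIV c \<and> (\<forall>\<theta>. c (\<theta> + 2 * pi) = c \<theta>) \<and>
             (\<forall>\<theta>. vector_derivative c (at \<theta>) \<noteq> 0)}"

definition D_ang :: "(real \<Rightarrow> complex) \<Rightarrow> real \<Rightarrow> complex" where
  "D_ang c \<theta> = vector_derivative c (at \<theta>)"

definition D_time :: "real \<Rightarrow> real \<Rightarrow> (real \<Rightarrow> real \<Rightarrow> complex) \<Rightarrow> real \<Rightarrow> real \<Rightarrow> complex" where
  "D_time a b c t \<theta> = vector_derivative (\<lambda>\<tau>. c \<tau> \<theta>) (at t within {a..b})"

definition curve_length :: "(real \<Rightarrow> complex) \<Rightarrow> real" where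
  "curve_length c = integral {0..2 * pi} (\<lambda>\<theta>. norm (D_ang c \<theta>))"

definition curvature :: "(real \<Rightarrow> complex) \<Rightarrow> real \<Rightarrow> real" where
  "curvature c \<theta> =
     (THE k. D_ang (\<lambda>\<eta>. D_ang c \<eta> /\<^sub>R norm (D_ang c \<eta>)) \<theta> = \<i> * of_real k * D_ang c \<theta>)"

definition conf_metric ::
    "(real \<Rightarrow> real) \<Rightarrow> (real \<Rightarrow> complex) \<Rightarrow> (real \<Rightarrow> complex) \<Rightarrow> (real \<Rightarrow> complex) \<Rightarrow> real" where
  "conf_metric \<phi> c h k =
     \<phi> (curve_length c) * integral {0..2 * pi} (\<lambda>\<theta>. (h \<theta> \<bullet> k \<theta>) * norm (D_ang c \<theta>))"

definition smooth_path :: "real \<Rightarrow> real \<Rightarrow> (real \<Rightarrow> real \<Rightarrow> complex) \<Rightarrow> bool" where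
  "smooth_path a b c \<longleftrightarrow>
     smooth_on ({a..b} \<times> UNIV) (\<lambda>(t, \<theta>). c t \<theta>) \<and> (\<forall>t\<in>{a..b}. c t \<in> Imm)"

definition energy :: "(real \<Rightarrow> real) \<Rightarrow> real \<Rightarrow> real \<Rightarrow> (real \<Rightarrow> real \<Rightarrow> complex) \<Rightarrow> real" where
  "energy \<phi> a b c =
     1 / 2 * integral {a..b} (\<lambda>t. conf_metric \<phi> (c t) (D_time a b c t) (D_time a b c t))"

definition fixed_endpoint_variation ::
    "real \<Rightarrow> real \<Rightarrow> (real \<Rightarrow> real \<Rightarrow> complex) \<Rightarrow> real \<Rightarrow> (real \<Rightarrow> real \<Rightarrow> real \<Rightarrow> complex) \<Rightarrow> bool" where
  "fixed_endpoint_variation a b c \<epsilon> V \<longleftrightarrow>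
     smooth_on ({-\<epsilon><..<\<epsilon>} \<times> {a..b} \<times> UNIV) (\<lambda>(s, t, \<theta>). V s t \<theta>) \<and>
     (\<forall>s\<in>{-\<epsilon><..<\<epsilon>}. \<forall>t\<in>{a..b}. V s t \<in> Imm) \<and>
     (\<forall>t\<in>{a..b}. V 0 t = c t) \<and>
     (\<forall>s\<in>{-\<epsilon><..<\<epsilon>}. V s a = c a \<and> V s b = c b)"

definition geodesic :: "(real \<Rightarrow> real) \<Rightarrow> real \<Rightarrow> real \<Rightarrow> (real \<Rightarrow> real \<Rightarrow> complex) \<Rightarrow> bool" where
  "geodesic \<phi> a b c \<longleftrightarrow>
     smooth_path a b c \<and>
     (\<forall>\<epsilon> V. \<epsilon> > 0 \<longrightarrow> fixed_endpoint_variation a b c \<epsilon> V \<longrightarrow>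
        ((\<lambda>s. energy \<phi> a b (V s)) has_real_derivative 0) (at 0))"

end

theory Submission
  imports Defs
begin

text \<open>The differential of the energy along a variation \<open>V\<close> of \<open>c\<close> with velocity field
\<open>W = \<partial>\<^sub>s V\<close> has the form \<open>\<integral>\<integral> Grad \<bullet> W d\<theta> dt\<close>, where \<open>Grad\<close> is the \<open>L\<^sup>2\<close> gradient of the energy,
and \<open>- Grad\<close> turns out to be the left side minus the right side of the geodesic equation. So the
equation makes every such differential vanish; and if every differential vanishes, enough test
fields \<open>W\<close> force \<open>Grad = 0\<close>.

The formula for the differential (\<open>first_variation\<close>) comes from differentiating
\<open>\<phi>(\<ell>) \<integral> |c\<^sub>t|\<^sup>2 |c\<^sub>\<theta>| d\<theta>\<close> in \<open>s\<close> under the integral signs and moving all derivatives off \<open>W\<close>. The terms with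
\<open>W\<^sub>\<theta>\<close> pair with \<open>c\<^sub>\<theta>/|c\<^sub>\<theta>|\<close>, which arises from the length and yields the curvature term, and with
\<open>|c\<^sub>t|\<^sup>2 c\<^sub>\<theta>/|c\<^sub>\<theta>|\<close>; integrating by parts over the closed curve leaves no boundary terms
(\<open>energy_rate_eq\<close>). The term with \<open>W\<^sub>t\<close> pairs with the momentum \<open>\<phi>(\<ell>) |c\<^sub>\<theta>| c\<^sub>t\<close>, and the boundary terms
vanish because the endpoints are fixed (\<open>integral_pairing_t\<close>). Both steps need
\<open>\<partial>\<^sub>s\<close> to commute with \<open>\<partial>\<^sub>t\<close> and \<open>\<partial>\<^sub>\<theta>\<close>, even at the end times, where time derivatives are one-sided;
\<open>mixed_partials\<close> supplies this. The dictionary between \<open>Grad\<close> and the geodesic equation is \<open>geodesic_defect_eq\<close>.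

For the converse, the test fields are \<open>(t - a)(b - t) p(t)\<^sup>n q(\<theta>)\<^sup>m e\<close> with a constant vector \<open>e\<close>, a polynomial
\<open>p\<close> that peaks at \<open>t\<^sub>0\<close> and \<open>q(\<theta>) = 1 + cos (\<theta> - \<theta>\<^sub>0)\<close>. High powers concentrate at the peaks
(\<open>concentrated_powers\<close>), so orthogonality to all of them gives \<open>Grad(t\<^sub>0,\<theta>\<^sub>0) = 0\<close> at interior points, and
continuity and periodicity take care of the rest. Such fields are genuine variations
(\<open>perturbation\<close>): they are smooth for elementary reasons, and a small multiple of them does not
destroy the immersion property.\<close>

section \<open>Smooth functions on sets with unique derivatives\<close>

lemma smooth_on_frechet:
  "smooth_on S f \<Longrightarrow> smooth_on S (\<lambda>x. frechet_derivative f (at x within S) v)"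
  unfolding smooth_on_def by (metis Ck_on.simps(2))

lemma smooth_on_has_derivative:
  assumes "smooth_on S f" "x \<in> S"
  shows "(f has_derivative frechet_derivative f (at x within S)) (at x within S)"
proof -
  have "Ck_on (Suc 0) f S"
    using assms(1) unfolding smooth_on_def by blast
  then show ?thesis
    using assms(2) unfolding Ck_on.simps differentiable_on_def frechet_derivative_works by blast
qed

lemma smooth_on_continuous: "smooth_on S f \<Longrightarrow> continuous_on S f"
  unfolding smooth_on_def by (metis Ck_on.simps(1))

text \<open>Derivatives within \<open>S\<close> are determined at \<open>x\<close> when \<open>S\<close> contains points arbitrarily close to \<open>x\<close> on every
coordinate line; one side of each line suffices, so boundary faces of a box are covered.\<close>
definition thick :: "'a::euclidean_space set \<Rightarrow> bool" where
  "thick S \<longleftrightarrow> (\<forall>x\<in>S. \<forall>i\<in>Basis. \<forall>e>0. \<exists>d. 0 < \<bar>d\<bar> \<and> \<bar>d\<bar> < e \<and> x + d *\<^sub>R i \<in> S)"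

lemma thick_frechet:
  assumes "thick S" "x \<in> S" "(f has_derivative f') (at x within S)"
  shows "frechet_derivative f (at x within S) = f'"
proof (rule frechet_derivative_unique_within[OF _ assms(3)])
  show "(f has_derivative frechet_derivative f (at x within S)) (at x within S)"
    using assms(3) differentiableI frechet_derivative_works by blast
qed (use assms in \<open>auto simp: thick_def\<close>)

lemma Ck_on_cong:
  "(\<And>x. x \<in> S \<Longrightarrow> f x = g x) \<Longrightarrow> Ck_on k f S \<longleftrightarrow> Ck_on k g S"
proof (induction k arbitrary: f g)
  case 0
  then show ?case by (simp cong: continuous_on_cong)
next
  case (Suc k)
  have D: "(f has_derivative f') (at x within S) \<longleftrightarrow> (g has_derivative f') (at x within S)"
    if "x \<in> S" for x f'
    using that Suc.prems by (metis has_derivative_transform)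
  have 1: "f differentiable_on S \<longleftrightarrow> g differentiable_on S"
    unfolding differentiable_on_def differentiable_def using D by blast
  have 2: "frechet_derivative f (at x within S) = frechet_derivative g (at x within S)"
    if "x \<in> S" for x
    unfolding frechet_derivative_def using D that by simp
  have "Ck_on k (\<lambda>x. frechet_derivative f (at x within S) v) S \<longleftrightarrow>
        Ck_on k (\<lambda>x. frechet_derivative g (at x within S) v) S" for v
    by (rule Suc.IH) (simp add: 2)
  with 1 show ?case by simp
qed

text \<open>Smoothness asserts that derivatives can be taken forever. It therefore suffices to exhibit a class of
functions that contains the given one and is closed under directional derivatives; no computation
with the iterated derivatives is required.\<close>
lemma smooth_on_coinduct:
  fixes f :: "'a::euclidean_space \<Rightarrow> 'b::real_normed_vector"
  assumes S: "thick S" and "P f"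
    and step: "\<And>f. P f \<Longrightarrow>
      \<exists>f'. (\<forall>x\<in>S. (f has_derivative f' x) (at x within S)) \<and> (\<forall>v. P (\<lambda>x. f' x v))"
  shows "smooth_on S f"
proof -
  have "P f \<Longrightarrow> Ck_on k f S" for k and f :: "'a \<Rightarrow> 'b"
  proof (induction k arbitrary: f)
    case 0
    obtain f' where "\<And>x. x \<in> S \<Longrightarrow> (f has_derivative f' x) (at x within S)"
      using step[OF 0] by blast
    then show ?case
      by (simp, rule has_derivative_continuous_on)
  next
    case (Suc k)
    obtain f' where f': "\<And>x. x \<in> S \<Longrightarrow> (f has_derivative f' x) (at x within S)"
      and P: "\<And>v. P (\<lambda>x. f' x v)"
      using step[OF Suc.prems] by blast
    have "Ck_on k (\<lambda>x. frechet_derivative f (at x within S) v) S \<longleftrightarrow> Ck_on k (\<lambda>x. f' x v) S" for v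
      by (rule Ck_on_cong) (simp add: thick_frechet[OF S _ f'])
    with Suc.IH[OF P] f' show ?case
      by (auto simp: differentiable_on_def intro: differentiableI)
  qed
  with \<open>P f\<close> show ?thesis by (simp add: smooth_on_def)
qed

lemma smooth_on_add:
  assumes S: "thick S" and "smooth_on S f" "smooth_on S g"
  shows "smooth_on S (\<lambda>x. f x + g x)"
proof (rule smooth_on_coinduct[OF S,
      where P = "\<lambda>h. \<exists>f g. smooth_on S f \<and> smooth_on S g \<and> h = (\<lambda>x. f x + g x)"])
  show "\<exists>f' g'. smooth_on S f' \<and> smooth_on S g' \<and> (\<lambda>x. f x + g x) = (\<lambda>x. f' x + g' x)"
    using assms by blast
next
  fix h :: "'a \<Rightarrow> 'b" assume "\<exists>f g. smooth_on S f \<and> smooth_on S g \<and> h = (\<lambda>x. f x + g x)"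
  then obtain f g where *: "smooth_on S f" "smooth_on S g" "h = (\<lambda>x. f x + g x)" by blast
  show "\<exists>f'. (\<forall>x\<in>S. (h has_derivative f' x) (at x within S)) \<and>
      (\<forall>v. \<exists>f g. smooth_on S f \<and> smooth_on S g \<and> (\<lambda>x. f' x v) = (\<lambda>x. f x + g x))"
    unfolding *(3)
    by (rule exI[of _ "\<lambda>x v. frechet_derivative f (at x within S) v + frechet_derivative g (at x within S) v"])
       (use *(1,2) in \<open>auto intro!: has_derivative_add smooth_on_has_derivative intro: smooth_on_frechet\<close>)
qed

lemma smooth_on_comp_snd:
  fixes f :: "'b::euclidean_space \<Rightarrow> 'c::real_normed_vector" and A :: "'a::euclidean_space set"
  assumes S: "thick (A \<times> T)" and "smooth_on T f"
  shows "smooth_on (A \<times> T) (\<lambda>x. f (snd x))"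
proof (rule smooth_on_coinduct[OF S, where P = "\<lambda>h. \<exists>f. smooth_on T f \<and> h = (\<lambda>x. f (snd x))"])
  show "\<exists>f'. smooth_on T f' \<and> (\<lambda>x::'a \<times> 'b. f (snd x)) = (\<lambda>x. f' (snd x))"
    using assms by blast
next
  fix h :: "'a \<times> 'b \<Rightarrow> 'c" assume "\<exists>f. smooth_on T f \<and> h = (\<lambda>x. f (snd x))"
  then obtain f where *: "smooth_on T f" "h = (\<lambda>x. f (snd x))" by blast
  have D: "(h has_derivative (\<lambda>v. frechet_derivative f (at (snd x) within T) (snd v))) (at x within A \<times> T)"
    if "x \<in> A \<times> T" for x
    unfolding *(2)
    by (rule has_derivative_in_compose2[where g = f and f = snd and t = T])
       (use that * in \<open>auto intro!: derivative_eq_intros smooth_on_has_derivative\<close>)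
  show "\<exists>f'. (\<forall>x\<in>A \<times> T. (h has_derivative f' x) (at x within A \<times> T)) \<and>
      (\<forall>v. \<exists>f. smooth_on T f \<and> (\<lambda>x. f' x v) = (\<lambda>x. f (snd x)))"
    by (rule exI[of _ "\<lambda>x v. frechet_derivative f (at (snd x) within T) (snd v)"])
       (use D smooth_on_frechet[OF *(1)] in auto)
qed

text \<open>A class of test functions of \<open>(s, t, \<theta>)\<close> that is visibly closed under directional derivatives. It
contains fields that vanish at prescribed times and that peak at prescribed points.\<close>
inductive trig_poly :: "(real \<times> real \<times> real \<Rightarrow> complex) \<Rightarrow> bool" where
  const: "trig_poly (\<lambda>x. z)"
| var_s: "trig_poly (\<lambda>x. of_real (fst x))"
| var_t: "trig_poly (\<lambda>x. of_real (fst (snd x)))"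
| sin: "trig_poly (\<lambda>x. of_real (sin (snd (snd x) - \<omega>)))"
| cos: "trig_poly (\<lambda>x. of_real (cos (snd (snd x) - \<omega>)))"
| add: "trig_poly f \<Longrightarrow> trig_poly g \<Longrightarrow> trig_poly (\<lambda>x. f x + g x)"
| mult: "trig_poly f \<Longrightarrow> trig_poly g \<Longrightarrow> trig_poly (\<lambda>x. f x * g x)"

lemma trig_poly_power: "trig_poly f \<Longrightarrow> trig_poly (\<lambda>x. f x ^ n)"
  by (induction n) (auto intro: trig_poly.intros)

lemma trig_poly_derivative:
  "trig_poly f \<Longrightarrow> \<exists>f'. (\<forall>x. (f has_derivative f' x) (at x)) \<and> (\<forall>v. trig_poly (\<lambda>x. f' x v))"
proof (induction rule: trig_poly.induct)
  case (const z)
  show ?case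
    by (rule exI[of _ "\<lambda>x v. 0"]) (auto intro: trig_poly.const)
next
  case var_s
  show ?case
    by (rule exI[of _ "\<lambda>x v. of_real (fst v)"])
       (auto intro!: derivative_eq_intros intro: trig_poly.const)
next
  case var_t
  show ?case
    by (rule exI[of _ "\<lambda>x v. of_real (fst (snd v))"])
       (auto intro!: derivative_eq_intros intro: trig_poly.const)
next
  case (sin \<omega>)
  have "trig_poly (\<lambda>x. of_real (cos (snd (snd x) - \<omega>)) * of_real (snd (snd v)))" 
    for v :: "real \<times> real \<times> real"
    by (intro trig_poly.intros)
  then show ?case
    by (intro exI[of _ "\<lambda>x v. of_real (cos (snd (snd x) - \<omega>)) * of_real (snd (snd v))"])
       (auto intro!: derivative_eq_intros)
next
  case (cos \<omega>)
  have "trig_poly (\<lambda>x. (of_real (sin (snd (snd x) - \<omega>)) * of_real (- snd (snd v))))" 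
    for v :: "real \<times> real \<times> real"
    by (intro trig_poly.intros)
  then show ?case
    by (intro exI[of _ "\<lambda>x v. of_real (sin (snd (snd x) - \<omega>)) * of_real (- snd (snd v))"])
       (auto intro!: derivative_eq_intros)
next
  case (add f g)
  then obtain f' g' where "\<forall>x. (f has_derivative f' x) (at x)" "\<forall>v. trig_poly (\<lambda>x. f' x v)"
    "\<forall>x. (g has_derivative g' x) (at x)" "\<forall>v. trig_poly (\<lambda>x. g' x v)"
    by metis
  then show ?case
    by (intro exI[of _ "\<lambda>x v. f' x v + g' x v"])
       (auto intro!: has_derivative_add trig_poly.add)
next
  case (mult f g)
  then obtain f' g' where "\<forall>x. (f has_derivative f' x) (at x)" "\<forall>v. trig_poly (\<lambda>x. f' x v)"
    "\<forall>x. (g has_derivative g' x) (at x)" "\<forall>v. trig_poly (\<lambda>x. g' x v)"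
    by metis
  then show ?case using mult.hyps
    by (intro exI[of _ "\<lambda>x v. f x * g' x v + f' x v * g x"])
       (auto intro!: has_derivative_mult trig_poly.add trig_poly.mult)
qed

lemma trig_poly_smooth: "thick S \<Longrightarrow> trig_poly f \<Longrightarrow> smooth_on S f"
proof (erule smooth_on_coinduct[where P = trig_poly])
  fix g assume "trig_poly g"
  from trig_poly_derivative[OF this]
  show "\<exists>f'. (\<forall>x\<in>S. (g has_derivative f' x) (at x within S)) \<and> (\<forall>v. trig_poly (\<lambda>x. f' x v))"
    using has_derivative_at_withinI by blast
qed

section \<open>Powers that concentrate at a maximum\<close>

text \<open>If \<open>r x0 > 0\<close>, then near \<open>x0\<close> the integrand is at least \<open>\<gamma>'\<^sup>n r(x0)/2\<close>, while outside a neighbourhood of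
\<open>x0\<close> it is at most \<open>\<gamma>\<^sup>n M\<close> in absolute value, with \<open>\<gamma> < \<gamma>'\<close>. For large \<open>n\<close> the positive part wins, so the
integral cannot vanish.\<close>
lemma concentrated_powers_aux:
  fixes w r :: "real \<Rightarrow> real"
  assumes x0: "\<alpha> < x0" "x0 < \<beta>"
    and w: "continuous_on {\<alpha>..\<beta>} w" and r: "continuous_on {\<alpha>..\<beta>} r"
    and nn: "\<And>x. x \<in> {\<alpha>..\<beta>} \<Longrightarrow> 0 \<le> w x"
    and peak: "\<And>x. x \<in> {\<alpha>..\<beta>} \<Longrightarrow> x \<noteq> x0 \<Longrightarrow> w x < w x0"
    and int: "\<And>n. integral {\<alpha>..\<beta>} (\<lambda>x. w x ^ n * r x) = 0"
  shows "r x0 \<le> 0"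
proof (rule ccontr)
  assume "\<not> r x0 \<le> 0"
  then have pos: "0 < r x0" by simp
  define \<rho> where "\<rho> = r x0 / 2"
  have near: "\<exists>d>0. \<forall>x\<in>{\<alpha>..\<beta>}. dist x x0 < d \<longrightarrow> k < f x"
    if "continuous_on {\<alpha>..\<beta>} f" "k < f x0" for f :: "real \<Rightarrow> real" and k
  proof -
    have "\<forall>\<^sub>F x in at x0 within {\<alpha>..\<beta>}. k < f x"
      using that x0 by (intro order_tendstoD(1)[of _ "f x0"]) (auto simp: continuous_on_def)
    then show ?thesis
      using that by (fastforce simp: eventually_at)
  qed
  obtain d0 where d0: "0 < d0" "\<And>x. x \<in> {\<alpha>..\<beta>} \<Longrightarrow> dist x x0 < d0 \<Longrightarrow> \<rho> < r x"
    using near[OF r, of \<rho>] pos by (auto simp: \<rho>_def)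
  define d where "d = min d0 (min (x0 - \<alpha>) (\<beta> - x0))"
  have d: "0 < d" "d \<le> x0 - \<alpha>" "d \<le> \<beta> - x0" "d \<le> d0"
    using d0 x0 by (auto simp: d_def)
  \<comment> \<open>Away from \<open>x0\<close> the weight \<open>w\<close> stays below \<open>\<gamma> < w x0\<close>, by compactness.\<close>
  define K where "K = {\<alpha>..\<beta>} - ball x0 d"
  have "compact K" unfolding K_def by (intro compact_diff) auto
  moreover have "\<alpha> \<in> K" using d x0 by (auto simp: K_def dist_real_def)
  moreover have "continuous_on K w" using w by (rule continuous_on_subset) (auto simp: K_def)
  ultimately obtain y where y: "y \<in> K" "\<And>x. x \<in> K \<Longrightarrow> w x \<le> w y"
    using continuous_attains_sup[of K w] by blast
  define \<gamma> where "\<gamma> = w y"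
  have "y \<noteq> x0" "y \<in> {\<alpha>..\<beta>}" using y(1) d by (auto simp: K_def)
  then have \<gamma>: "0 \<le> \<gamma>" "\<gamma> < w x0" using nn peak by (auto simp: \<gamma>_def)
  \<comment> \<open>A level strictly between \<open>\<gamma>\<close> and the maximum, still exceeded by \<open>w\<close> near \<open>x0\<close>.\<close>
  define \<gamma>' where "\<gamma>' = (\<gamma> + w x0) / 2"
  have \<gamma>': "\<gamma> < \<gamma>'" "\<gamma>' < w x0" using \<gamma> by (auto simp: \<gamma>'_def)
  obtain e0 where e0: "0 < e0" "\<And>x. x \<in> {\<alpha>..\<beta>} \<Longrightarrow> dist x x0 < e0 \<Longrightarrow> \<gamma>' < w x"
    using near[OF w \<gamma>'(2)] by blast
  define e where "e = min e0 d / 2"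
  have e: "0 < e" "e < e0" "e < d" using e0 d by (auto simp: e_def)
  have "compact (r ` {\<alpha>..\<beta>})" by (intro compact_continuous_image r) auto
  then obtain M where M: "0 < M" "\<And>x. x \<in> {\<alpha>..\<beta>} \<Longrightarrow> \<bar>r x\<bar> \<le> M"
    using compact_imp_bounded bounded_pos by (metis image_eqI real_norm_def)
  have low: "(if x \<in> {x0 - e..x0 + e} then \<gamma>' ^ n * \<rho> else 0) - \<gamma> ^ n * M \<le> w x ^ n * r x"
    if x: "x \<in> {\<alpha>..\<beta>}" for x n
  proof (cases "dist x x0 < d")
    case True
    then have r0: "\<rho> < r x" using d0 d x by auto
    have g: "0 \<le> \<gamma> ^ n * M" using \<gamma> M by auto
    show ?thesis
    proof (cases "x \<in> {x0 - e..x0 + e}")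
      case True
      then have "\<gamma>' < w x" using e e0(2)[OF x] by (auto simp: dist_real_def)
      then have "\<gamma>' ^ n * \<rho> \<le> w x ^ n * r x"
        using r0 \<gamma> \<gamma>' pos by (intro mult_mono power_mono) (auto simp: \<rho>_def intro!: nn x)
      with True g show ?thesis by auto
    next
      case False
      have "0 \<le> w x ^ n * r x" using r0 pos nn x by (auto simp: \<rho>_def)
      with False g show ?thesis by auto
    qed
  next
    case False
    then have "x \<in> K" using x by (auto simp: K_def dist_commute)
    then have "w x \<le> \<gamma>" using y by (auto simp: \<gamma>_def)
    then have "\<bar>w x ^ n * r x\<bar> \<le> \<gamma> ^ n * M"
      unfolding abs_mult using M nn x \<gamma>
      by (intro mult_mono) (auto intro: power_mono simp: power_abs)
    moreover have "x \<notin> {x0 - e..x0 + e}" using False e by (auto simp: dist_real_def)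
    ultimately show ?thesis by auto
  qed
  have bound: "2 * e * \<rho> \<le> (\<beta> - \<alpha>) * M * (\<gamma> / \<gamma>') ^ n" for n
  proof -
    have "((\<lambda>x. \<gamma>' ^ n * \<rho>) has_integral (2 * e * (\<gamma>' ^ n * \<rho>))) {x0 - e..x0 + e}"
      using has_integral_const_real[of "\<gamma>' ^ n * \<rho>" "x0 - e" "x0 + e"] e by simp
    then have "((\<lambda>x. if x \<in> {x0 - e..x0 + e} then \<gamma>' ^ n * \<rho> else 0) has_integral (2 * e * (\<gamma>' ^ n * \<rho>))) {\<alpha>..\<beta>}"
      using e d by (subst has_integral_restrict) auto
    moreover have "((\<lambda>x. \<gamma> ^ n * M) has_integral ((\<beta> - \<alpha>) * (\<gamma> ^ n * M))) {\<alpha>..\<beta>}"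
      using has_integral_const_real[of "\<gamma> ^ n * M" \<alpha> \<beta>] x0 by auto
    ultimately have 1: "((\<lambda>x. (if x \<in> {x0 - e..x0 + e} then \<gamma>' ^ n * \<rho> else 0) - \<gamma> ^ n * M) has_integral
         (2 * e * (\<gamma>' ^ n * \<rho>) - (\<beta> - \<alpha>) * (\<gamma> ^ n * M))) {\<alpha>..\<beta>}"
      by (rule has_integral_diff)
    have "(\<lambda>x. w x ^ n * r x) integrable_on {\<alpha>..\<beta>}"
      by (intro integrable_continuous_real continuous_intros w r)
    then have 2: "((\<lambda>x. w x ^ n * r x) has_integral 0) {\<alpha>..\<beta>}"
      using int[of n] integrable_integral by metis
    have "2 * e * (\<gamma>' ^ n * \<rho>) - (\<beta> - \<alpha>) * (\<gamma> ^ n * M) \<le> 0"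
      by (rule has_integral_le[OF 1 2]) (use low in auto)
    moreover have "0 < \<gamma>' ^ n" using \<gamma> \<gamma>' by auto
    ultimately show ?thesis by (simp add: field_simps power_divide)
  qed
  have "(\<lambda>n. (\<beta> - \<alpha>) * M * (\<gamma> / \<gamma>') ^ n) \<longlonglongrightarrow> (\<beta> - \<alpha>) * M * 0"
    using \<gamma> \<gamma>' by (intro tendsto_mult tendsto_const LIMSEQ_power_zero) auto
  then have "2 * e * \<rho> \<le> (\<beta> - \<alpha>) * M * 0"
    using bound by (intro LIMSEQ_le_const) auto
  then show False using e pos by (simp add: \<rho>_def mult_le_0_iff)
qed

lemma concentrated_powers:
  fixes w r :: "real \<Rightarrow> real"
  assumes x0: "\<alpha> < x0" "x0 < \<beta>"
    and w: "continuous_on {\<alpha>..\<beta>} w" and r: "continuous_on {\<alpha>..\<beta>} r"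
    and nn: "\<And>x. x \<in> {\<alpha>..\<beta>} \<Longrightarrow> 0 \<le> w x"
    and peak: "\<And>x. x \<in> {\<alpha>..\<beta>} \<Longrightarrow> x \<noteq> x0 \<Longrightarrow> w x < w x0"
    and int: "\<And>n. integral {\<alpha>..\<beta>} (\<lambda>x. w x ^ n * r x) = 0"
  shows "r x0 = 0"
proof -
  have "r x0 \<le> 0" by (rule concentrated_powers_aux[OF assms])
  moreover have "- r x0 \<le> 0"
    by (rule concentrated_powers_aux[OF x0 w continuous_on_minus[OF r] nn peak]) (use int in auto)
  ultimately show ?thesis by simp
qed

section \<open>One-variable calculus\<close>

lemma has_real_derivative_inner:
  fixes f g :: "real \<Rightarrow> 'a::real_inner"
  assumes "(f has_vector_derivative f') (at x within S)" "(g has_vector_derivative g') (at x within S)"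
  shows "((\<lambda>x. f x \<bullet> g x) has_real_derivative (f x \<bullet> g' + f' \<bullet> g x)) (at x within S)"
  unfolding has_real_derivative_iff_has_vector_derivative
  by (rule bounded_bilinear.has_vector_derivative[OF bounded_bilinear_inner assms])

lemma has_real_derivative_norm:
  fixes f :: "real \<Rightarrow> 'a::real_inner"
  assumes f: "(f has_vector_derivative f') (at x within S)" and "f x \<noteq> 0"
  shows "((\<lambda>x. norm (f x)) has_real_derivative (f x \<bullet> f' / norm (f x))) (at x within S)"
proof -
  have "(sqrt has_real_derivative inverse (sqrt (f x \<bullet> f x)) / 2) (at (f x \<bullet> f x))"
    using assms(2) by (intro DERIV_real_sqrt) simp
  from DERIV_chain2[OF this has_real_derivative_inner[OF f f]]
  have "((\<lambda>x. norm (f x)) has_real_derivative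
      inverse (norm (f x)) / 2 * (f x \<bullet> f' + f' \<bullet> f x)) (at x within S)"
    by (simp only: norm_eq_sqrt_inner)
  then show ?thesis
    by (rule DERIV_cong) (simp add: inner_commute[of f'] field_simps)
qed

text \<open>Symmetry of the mixed derivatives on a closed interval in \<open>t\<close>, endpoints included. Differentiating
\<open>f s \<tau> - f s \<alpha> = \<integral> ft s\<close> in \<open>s\<close> under the integral shows that \<open>fs s\<close> is, up to a constant, an
antiderivative of \<open>fts s\<close>. Of the two mixed derivatives only \<open>fts\<close> is
assumed to exist and to be continuous.\<close>
lemma mixed_partials:
  fixes f :: "real \<Rightarrow> real \<Rightarrow> 'b::banach"
  assumes U: "open U" "convex U" and st: "s \<in> U" "t \<in> {\<alpha>..\<beta>}"
    and ft: "\<And>s t. s \<in> U \<Longrightarrow> t \<in> {\<alpha>..\<beta>} \<Longrightarrow> (f s has_vector_derivative ft s t) (at t within {\<alpha>..\<beta>})"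
    and fs: "\<And>s t. s \<in> U \<Longrightarrow> t \<in> {\<alpha>..\<beta>} \<Longrightarrow> ((\<lambda>s. f s t) has_vector_derivative fs s t) (at s within U)"
    and fts: "\<And>s t. s \<in> U \<Longrightarrow> t \<in> {\<alpha>..\<beta>} \<Longrightarrow> ((\<lambda>s. ft s t) has_vector_derivative fts s t) (at s within U)"
    and cont: "continuous_on (U \<times> {\<alpha>..\<beta>}) (\<lambda>(s, t). fts s t)"
  shows "(fs s has_vector_derivative fts s t) (at t within {\<alpha>..\<beta>})"
proof -
  have \<alpha>: "\<alpha> \<in> {\<alpha>..\<beta>}" using st by auto
  have cs: "continuous_on {\<alpha>..\<beta>} (fts s)"
    by (rule continuous_on_compose2[OF cont, of _ "\<lambda>t. (s, t)", simplified]) (use st in \<open>auto intro!: continuous_intros\<close>)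
  have eq: "fs s \<tau> = fs s \<alpha> + integral {\<alpha>..\<tau>} (fts s)" if \<tau>: "\<tau> \<in> {\<alpha>..\<beta>}" for \<tau>
  proof -
    have ftc: "(ft \<sigma> has_integral (f \<sigma> \<tau> - f \<sigma> \<alpha>)) {\<alpha>..\<tau>}" if "\<sigma> \<in> U" for \<sigma>
      by (rule fundamental_theorem_of_calculus)
         (use \<tau> in \<open>auto intro!: has_vector_derivative_within_subset[OF ft[OF that]]\<close>)
    have "((\<lambda>\<sigma>. integral (cbox \<alpha> \<tau>) (ft \<sigma>)) has_vector_derivative integral (cbox \<alpha> \<tau>) (fts s)) (at s within U)"
      by (rule leibniz_rule_vector_derivative)
         (use \<tau> st U ftc in \<open>auto intro!: fts continuous_on_subset[OF cont]\<close>)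
    then have "((\<lambda>\<sigma>. f \<sigma> \<tau> - f \<sigma> \<alpha>) has_vector_derivative integral {\<alpha>..\<tau>} (fts s)) (at s within U)"
      unfolding cbox_interval
      by (rule has_vector_derivative_transform[OF st(1), rotated]) (simp add: integral_unique[OF ftc])
    moreover have "((\<lambda>\<sigma>. f \<sigma> \<tau> - f \<sigma> \<alpha>) has_vector_derivative fs s \<tau> - fs s \<alpha>) (at s within U)"
      by (intro has_vector_derivative_diff fs st \<tau> \<alpha>)
    ultimately have "integral {\<alpha>..\<tau>} (fts s) = fs s \<tau> - fs s \<alpha>"
      unfolding at_within_open[OF st(1) U(1)] by (rule vector_derivative_unique_at)
    then show ?thesis by simp
  qed
  have "((\<lambda>\<tau>. fs s \<alpha> + integral {\<alpha>..\<tau>} (fts s)) has_vector_derivative (0 + fts s t)) (at t within {\<alpha>..\<beta>})"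
    by (intro has_vector_derivative_add has_vector_derivative_const integral_has_vector_derivative cs st)
  then have "((\<lambda>\<tau>. fs s \<alpha> + integral {\<alpha>..\<tau>} (fts s)) has_vector_derivative fts s t) (at t within {\<alpha>..\<beta>})"
    by simp
  then show ?thesis
    by (rule has_vector_derivative_transform[OF st(2), rotated]) (erule eq)
qed

lemma integral_by_parts_boundary_free:
  fixes f g :: "real \<Rightarrow> 'a::euclidean_space"
  assumes "\<alpha> \<le> \<beta>"
    and f: "\<And>x. x \<in> {\<alpha>..\<beta>} \<Longrightarrow> (f has_vector_derivative f' x) (at x within {\<alpha>..\<beta>})"
    and g: "\<And>x. x \<in> {\<alpha>..\<beta>} \<Longrightarrow> (g has_vector_derivative g' x) (at x within {\<alpha>..\<beta>})"
    and cont: "continuous_on {\<alpha>..\<beta>} f'" "continuous_on {\<alpha>..\<beta>} g'"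
    and bdry: "f \<beta> \<bullet> g \<beta> = f \<alpha> \<bullet> g \<alpha>"
  shows "integral {\<alpha>..\<beta>} (\<lambda>x. f x \<bullet> g' x) = - integral {\<alpha>..\<beta>} (\<lambda>x. f' x \<bullet> g x)"
proof -
  have fg: "continuous_on {\<alpha>..\<beta>} f" "continuous_on {\<alpha>..\<beta>} g"
    using f g by (meson continuous_on_vector_derivative)+
  have "((\<lambda>x. f x \<bullet> g' x + f' x \<bullet> g x) has_integral (f \<beta> \<bullet> g \<beta> - f \<alpha> \<bullet> g \<alpha>)) {\<alpha>..\<beta>}"
    by (rule fundamental_theorem_of_calculus[OF assms(1)])
       (intro has_real_derivative_inner[unfolded has_real_derivative_iff_has_vector_derivative] f g; assumption)
  moreover have "integral {\<alpha>..\<beta>} (\<lambda>x. f x \<bullet> g' x + f' x \<bullet> g x) =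
      integral {\<alpha>..\<beta>} (\<lambda>x. f x \<bullet> g' x) + integral {\<alpha>..\<beta>} (\<lambda>x. f' x \<bullet> g x)"
    by (intro integral_add integrable_continuous_real continuous_intros fg cont)
  ultimately show ?thesis using bdry by (simp add: integral_unique)
qed

lemma periodic_representative:
  fixes f :: "real \<Rightarrow> 'a"
  assumes "\<And>x. f (x + 2 * pi) = f x"
  obtains y where "y \<in> {0..2 * pi}" "f x = f y"
proof -
  interpret periodic_fun_simple f "2 * pi"
    by standard (rule assms)
  define n where "n = \<lfloor>x / (2 * pi)\<rfloor>"
  have "of_int n \<le> x / (2 * pi)" "x / (2 * pi) \<le> of_int n + 1"
    unfolding n_def by linarith+
  then have "x - of_int n * (2 * pi) \<in> {0..2 * pi}"
    by (auto simp: field_simps)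
  moreover have "f x = f (x - of_int n * (2 * pi))"
    by (simp add: minus_of_int)
  ultimately show ?thesis using that by blast
qed

text \<open>The definite description in the definition of the curvature denotes: the unit tangent has constant length, so its
derivative is orthogonal to the tangent and hence a real multiple of \<open>\<i> c\<^sub>\<theta>\<close>.\<close>
lemma curvature_eqn:
  assumes c: "\<And>\<eta>. D_ang c \<eta> \<noteq> 0" and c': "(D_ang c has_vector_derivative c') (at \<theta>)"
  shows "\<i> * of_real (curvature c \<theta>) * D_ang c \<theta> = D_ang (\<lambda>\<eta>. D_ang c \<eta> /\<^sub>R norm (D_ang c \<eta>)) \<theta>"
proof -
  define T where "T = (\<lambda>\<eta>. D_ang c \<eta> /\<^sub>R norm (D_ang c \<eta>))"
  have "((\<lambda>\<eta>. inverse (norm (D_ang c \<eta>)) *\<^sub>R D_ang c \<eta>) has_vector_derivative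
     (inverse (norm (D_ang c \<theta>)) *\<^sub>R c' +
       (- (inverse (norm (D_ang c \<theta>)) * (D_ang c \<theta> \<bullet> c' / norm (D_ang c \<theta>)) * inverse (norm (D_ang c \<theta>)))) *\<^sub>R D_ang c \<theta>)) (at \<theta>)"
    by (intro has_vector_derivative_scaleR c' DERIV_inverse' has_real_derivative_norm) (auto simp: c)
  then obtain T' where T': "(T has_vector_derivative T') (at \<theta>)" unfolding T_def by blast
  have "((\<lambda>\<eta>. T \<eta> \<bullet> T \<eta>) has_real_derivative (T \<theta> \<bullet> T' + T' \<bullet> T \<theta>)) (at \<theta>)"
    by (intro has_real_derivative_inner T')
  moreover have "(\<lambda>\<eta>. T \<eta> \<bullet> T \<eta>) = (\<lambda>\<eta>. 1)"
    using c by (auto simp: T_def dot_square_norm power2_eq_square)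
  ultimately have "((\<lambda>\<eta>. 1) has_real_derivative (T \<theta> \<bullet> T' + T' \<bullet> T \<theta>)) (at \<theta>)" by simp
  from DERIV_unique[OF this DERIV_const] have "T \<theta> \<bullet> T' = 0"
    by (simp add: inner_commute)
  then have orth: "D_ang c \<theta> \<bullet> T' = 0"
    using c[of \<theta>] by (simp add: T_def)
  define z where "z = D_ang c \<theta>"
  have z: "z \<noteq> 0" using c by (simp add: z_def)
  have "Re z * Re T' + Im z * Im T' = 0" using orth by (simp add: z_def inner_complex_def)
  then have "Re (T' * cnj z) = 0" by (simp add: algebra_simps)
  then have "T' * cnj z = \<i> * of_real (Im (T' * cnj z))" by (auto simp: complex_eq_iff)
  then have "T' * (cnj z * z) = \<i> * of_real (Im (T' * cnj z)) * z" by (simp only: mult.assoc[symmetric])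
  then have "T' * of_real ((cmod z)\<^sup>2) = \<i> * of_real (Im (T' * cnj z)) * z"
    by (simp only: complex_norm_square mult.commute[of "cnj z" z])
  then have "T' = \<i> * of_real (Im (T' * cnj z)) * z / of_real ((cmod z)\<^sup>2)"
    using z by (simp add: eq_divide_eq)
  then have "T' = \<i> * of_real (Im (T' * cnj z) / (cmod z)\<^sup>2) * z"
    by (simp only: of_real_divide times_divide_eq_left times_divide_eq_right)
  then have ex: "T' = \<i> * of_real k * z" if "k = Im (T' * cnj z) / (cmod z)\<^sup>2" for k
    using that by simp
  have "\<exists>!k. T' = \<i> * of_real k * z"
  proof (rule ex_ex1I)
    show "\<exists>k. T' = \<i> * of_real k * z" using ex[OF refl] by blast
  qed (use z in auto)
  from theI'[OF this] have "T' = \<i> * of_real (THE k. T' = \<i> * of_real k * z) * z" .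
  moreover have "D_ang T \<theta> = T'" unfolding D_ang_def by (rule vector_derivative_at[OF T'])
  ultimately show ?thesis
    unfolding curvature_def T_def[symmetric] z_def by simp
qed

section \<open>Partial derivatives on products of intervals\<close>

definition partial :: "'a::euclidean_space set \<Rightarrow> 'a \<Rightarrow> ('a \<Rightarrow> 'b::real_normed_vector) \<Rightarrow> 'a \<Rightarrow> 'b" where
  "partial S v f x = frechet_derivative f (at x within S) v"

lemma smooth_on_partial: "smooth_on S f \<Longrightarrow> smooth_on S (partial S v f)"
  using smooth_on_frechet[of S f v] unfolding partial_def by simp

lemma has_vector_derivative_along:
  assumes f: "smooth_on S f" and p: "(p has_vector_derivative v) (at r within A)"
    and sub: "p ` A \<subseteq> S" and r: "r \<in> A"
  shows "((\<lambda>r. f (p r)) has_vector_derivative partial S v f (p r)) (at r within A)"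
proof -
  have lin: "linear (frechet_derivative f (at (p r) within S))"
    using smooth_on_has_derivative[OF f] sub r by (meson has_derivative_linear image_subset_iff)
  have "((\<lambda>r. f (p r)) has_derivative
      (\<lambda>h. frechet_derivative f (at (p r) within S) (h *\<^sub>R v))) (at r within A)"
    by (rule has_derivative_in_compose2[where g = f and f = p and t = S])
       (use assms in \<open>auto intro: smooth_on_has_derivative simp: has_vector_derivative_def\<close>)
  then show ?thesis
    by (simp add: has_vector_derivative_def partial_def linear_scale[OF lin])
qed

lemma thick_box:
  fixes a b \<epsilon> :: real
  assumes "0 < \<epsilon>" "a < b"
  shows "thick ({-\<epsilon><..<\<epsilon>} \<times> {a..b} \<times> (UNIV :: real set))"
  unfolding thick_def
proof (intro ballI allI impI)
  fix x i :: "real \<times> real \<times> real" and e :: real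
  assume x: "x \<in> {-\<epsilon><..<\<epsilon>} \<times> {a..b} \<times> UNIV" and i: "i \<in> Basis" and e: "0 < e"
  obtain s t \<theta> where st: "x = (s, t, \<theta>)" by (cases x)
  have s: "-\<epsilon> < s" "s < \<epsilon>" and t: "a \<le> t" "t \<le> b" using x st by auto
  from i consider "i = (1, 0, 0)" | "i = (0, 1, 0)" | "i = (0, 0, 1)"
    by (auto simp: Basis_prod_def zero_prod_def)
  then show "\<exists>d. 0 < \<bar>d\<bar> \<and> \<bar>d\<bar> < e \<and> x + d *\<^sub>R i \<in> {-\<epsilon><..<\<epsilon>} \<times> {a..b} \<times> UNIV"
  proof cases
    case 1
    then show ?thesis using s t e st
      by (intro exI[of _ "min e (\<epsilon> - s) / 2"]) (auto simp: min_def field_simps)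
  next
    case 2
    show ?thesis
    proof (cases "t < b")
      case True
      then show ?thesis using s t e st 2
        by (intro exI[of _ "min e (b - t) / 2"]) (auto simp: min_def field_simps)
    next
      case False
      then show ?thesis using s t e st 2 \<open>a < b\<close>
        by (intro exI[of _ "- min e (b - a) / 2"]) (auto simp: min_def field_simps)
    qed
  next
    case 3
    then show ?thesis using s t e st by (intro exI[of _ "e / 2"]) auto
  qed
qed

lemma thick_UNIV: "thick (UNIV :: 'a::euclidean_space set)"
  unfolding thick_def
proof (intro ballI allI impI)
  fix x i :: 'a and e :: real assume "0 < e"
  then show "\<exists>d. 0 < \<bar>d\<bar> \<and> \<bar>d\<bar> < e \<and> x + d *\<^sub>R i \<in> UNIV"
    by (intro exI[of _ "e / 2"]) simp
qed

text \<open>Each derivative in the angle is a slice of a directional derivative in the direction \<open>(0, 0, v)\<close>, so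
slices of smooth functions form a class to which \<open>smooth_on_coinduct\<close> applies.\<close>
lemma smooth_on_slice:
  fixes f :: "real \<times> real \<times> real \<Rightarrow> 'b::real_normed_vector"
  assumes f: "smooth_on (A \<times> B \<times> UNIV) f" and st: "s \<in> A" "t \<in> B"
  shows "smooth_on UNIV (\<lambda>\<theta>. f (s, t, \<theta>))"
proof -
  let ?S = "A \<times> B \<times> (UNIV :: real set)"
  show ?thesis
  proof (rule smooth_on_coinduct[OF thick_UNIV,
        where P = "\<lambda>h. \<exists>f. smooth_on ?S f \<and> h = (\<lambda>\<theta>. f (s, t, \<theta>))"])
    show "\<exists>f'. smooth_on ?S f' \<and> (\<lambda>\<theta>. f (s, t, \<theta>)) = (\<lambda>\<theta>. f' (s, t, \<theta>))"
      using f by blast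
  next
    fix h :: "real \<Rightarrow> 'b" assume "\<exists>f. smooth_on ?S f \<and> h = (\<lambda>\<theta>. f (s, t, \<theta>))"
    then obtain f where *: "smooth_on ?S f" "h = (\<lambda>\<theta>. f (s, t, \<theta>))" by blast
    have D: "(h has_derivative (\<lambda>v. frechet_derivative f (at (s, t, \<theta>) within ?S) (0, 0, v))) (at \<theta>)" for \<theta>
      unfolding *(2)
      by (rule has_derivative_in_compose2[where g = f and f = "\<lambda>\<theta>. (s, t, \<theta>)" and t = ?S])
         (use st * in \<open>auto intro!: derivative_eq_intros smooth_on_has_derivative\<close>)
    have "\<exists>g. smooth_on ?S g \<and>
        (\<lambda>\<theta>. frechet_derivative f (at (s, t, \<theta>) within ?S) (0, 0, v)) = (\<lambda>\<theta>. g (s, t, \<theta>))" for v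
      by (rule exI[of _ "\<lambda>x. frechet_derivative f (at x within ?S) (0, 0, v)"])
         (simp add: smooth_on_frechet[OF *(1)])
    with D show "\<exists>f'. (\<forall>\<theta>\<in>UNIV. (h has_derivative f' \<theta>) (at \<theta>)) \<and>
        (\<forall>v. \<exists>f. smooth_on ?S f \<and> (\<lambda>\<theta>. f' \<theta> v) = (\<lambda>\<theta>. f (s, t, \<theta>)))"
      by (intro exI[of _ "\<lambda>\<theta> v. frechet_derivative f (at (s, t, \<theta>) within ?S) (0, 0, v)"]
            conjI ballI allI)
  qed
qed

lemma continuous_on_param_integral:
  fixes f :: "real \<times> real \<times> real \<Rightarrow> 'b::banach"
  assumes "continuous_on (A \<times> B \<times> UNIV) f"
  shows "continuous_on (A \<times> B) (\<lambda>p. integral {\<alpha>..\<beta>} (\<lambda>\<theta>. f (fst p, snd p, \<theta>)))"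
proof -
  have "continuous_on ((A \<times> B) \<times> cbox \<alpha> \<beta>) (\<lambda>(p, \<theta>). f (fst p, snd p, \<theta>))"
    unfolding case_prod_beta
    by (rule continuous_on_compose2[OF assms]) (auto intro!: continuous_intros)
  from integral_continuous_on_param[OF this] show ?thesis by simp
qed

section \<open>Variations with fixed endpoints\<close>

text \<open>All facts about \<open>c\<close> that the first variation needs are read off from \<open>V\<close> at \<open>s = 0\<close>; the constant
variation is an instance, so \<open>c\<close> itself does not have to be treated separately.\<close>
locale curve_variation =
  fixes \<phi> :: "real \<Rightarrow> real" and a b \<epsilon> :: real
    and c :: "real \<Rightarrow> real \<Rightarrow> complex" and V :: "real \<Rightarrow> real \<Rightarrow> real \<Rightarrow> complex"
  assumes \<phi>: "smooth_on {0<..} \<phi>" and ab: "a < b" and \<epsilon>: "0 < \<epsilon>"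
    and var: "fixed_endpoint_variation a b c \<epsilon> V"
begin

abbreviation I where "I \<equiv> {-\<epsilon><..<\<epsilon>}"
abbreviation J where "J \<equiv> {a..b}"

definition "slab = I \<times> J \<times> (UNIV :: real set)"
definition "X = (\<lambda>(s, t, \<theta>). V s t \<theta>)"

text \<open>The letters \<open>s\<close>, \<open>t\<close>, \<open>h\<close> stand for the parameter of the variation, the time and the angle.\<close>
abbreviation "Ds \<equiv> partial slab (1, 0, 0)"
abbreviation "Dt \<equiv> partial slab (0, 1, 0)"
abbreviation "Dh \<equiv> partial slab (0, 0, 1)"

lemma in_slab [simp]: "(s, t, \<theta>) \<in> slab \<longleftrightarrow> s \<in> I \<and> t \<in> J"
  by (simp add: slab_def)

lemma zero_in_I [simp]: "0 \<in> I" using \<epsilon> by simp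

lemma smooth_X: "smooth_on slab X"
  using var unfolding fixed_endpoint_variation_def slab_def X_def by simp

lemma deriv_s:
  assumes "smooth_on slab f" "s \<in> I" "t \<in> J"
  shows "((\<lambda>s. f (s, t, \<theta>)) has_vector_derivative Ds f (s, t, \<theta>)) (at s within I)"
  by (rule has_vector_derivative_along[where p = "\<lambda>s. (s, t, \<theta>)" and A = I])
     (use assms in \<open>auto simp: has_vector_derivative_def zero_prod_def intro!: derivative_eq_intros\<close>)

lemma deriv_t:
  assumes "smooth_on slab f" "s \<in> I" "t \<in> J"
  shows "((\<lambda>t. f (s, t, \<theta>)) has_vector_derivative Dt f (s, t, \<theta>)) (at t within J)"
  by (rule has_vector_derivative_along[where p = "\<lambda>t. (s, t, \<theta>)" and A = J])
     (use assms in \<open>auto simp: has_vector_derivative_def zero_prod_def intro!: derivative_eq_intros\<close>)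

lemma deriv_h:
  assumes "smooth_on slab f" "s \<in> I" "t \<in> J"
  shows "((\<lambda>\<theta>. f (s, t, \<theta>)) has_vector_derivative Dh f (s, t, \<theta>)) (at \<theta>)"
  by (rule has_vector_derivative_along[where p = "\<lambda>\<theta>. (s, t, \<theta>)" and A = UNIV])
     (use assms in \<open>auto simp: has_vector_derivative_def zero_prod_def intro!: derivative_eq_intros\<close>)

lemma uniq_s:
  "s \<in> I \<Longrightarrow> (f has_vector_derivative u) (at s within I) \<Longrightarrow> (f has_vector_derivative v) (at s within I)
    \<Longrightarrow> u = v"
  using at_within_open[of s I] vector_derivative_unique_at by auto

lemma uniq_t:
  "t \<in> J \<Longrightarrow> (f has_vector_derivative u) (at t within J) \<Longrightarrow> (f has_vector_derivative v) (at t within J)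
    \<Longrightarrow> u = v"
  using ab vector_derivative_within_cbox[of a b t f] by (metis cbox_interval)

abbreviation "Xs \<equiv> Ds X"
abbreviation "Xt \<equiv> Dt X"
abbreviation "Xh \<equiv> Dh X"

lemmas smooth_intros = smooth_X smooth_on_partial

lemma continuous_partial:
  assumes "smooth_on slab f" "continuous_on S p" "p ` S \<subseteq> slab"
  shows "continuous_on S (\<lambda>x. f (p x))"
  using continuous_on_compose2[OF smooth_on_continuous[OF assms(1)]] assms(2,3) by blast

text \<open>The \<open>s\<close>-derivative of the energy contains \<open>Ds Xt\<close> and \<open>Ds Xh\<close>. These can be integrated by parts only
because they are derivatives of the velocity field \<open>Xs\<close> of the variation.\<close>
lemma deriv_Xs_t:
  assumes st: "s \<in> I" "t \<in> J"
  shows "((\<lambda>t. Xs (s, t, \<theta>)) has_vector_derivative Ds Xt (s, t, \<theta>)) (at t within J)"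
proof (rule mixed_partials[where U = I and f = "\<lambda>s t. X (s, t, \<theta>)" and ft = "\<lambda>s t. Xt (s, t, \<theta>)"
      and fs = "\<lambda>s t. Xs (s, t, \<theta>)" and fts = "\<lambda>s t. Ds Xt (s, t, \<theta>)"])
  show "continuous_on (I \<times> J) (\<lambda>(s, t). Ds Xt (s, t, \<theta>))"
    unfolding case_prod_beta
    by (rule continuous_partial) (auto intro!: smooth_intros continuous_intros)
qed (use st in \<open>simp_all add: deriv_s deriv_t smooth_intros\<close>)

lemma deriv_Xs_h:
  assumes st: "s \<in> I" "t \<in> J"
  shows "((\<lambda>\<theta>. Xs (s, t, \<theta>)) has_vector_derivative Ds Xh (s, t, \<theta>)) (at \<theta>)"
proof -
  let ?K = "{\<theta> - 1..\<theta> + 1}"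
  have "((\<lambda>\<theta>. Xs (s, t, \<theta>)) has_vector_derivative Ds Xh (s, t, \<theta>)) (at \<theta> within ?K)"
  proof (rule mixed_partials[where U = I and f = "\<lambda>s \<theta>. X (s, t, \<theta>)" and ft = "\<lambda>s \<theta>. Xh (s, t, \<theta>)"
        and fs = "\<lambda>s \<theta>. Xs (s, t, \<theta>)" and fts = "\<lambda>s \<theta>. Ds Xh (s, t, \<theta>)"])
    show "continuous_on (I \<times> ?K) (\<lambda>(s, \<theta>). Ds Xh (s, t, \<theta>))"
      unfolding case_prod_beta
      by (rule continuous_partial) (use st in \<open>auto intro!: smooth_intros continuous_intros\<close>)
  qed (use st in \<open>simp_all add: deriv_s deriv_h smooth_intros has_vector_derivative_at_within\<close>)
  then show ?thesis
    by (simp add: at_within_Icc_at)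
qed

lemma D_time_V: "s \<in> I \<Longrightarrow> t \<in> J \<Longrightarrow> D_time a b (V s) t \<theta> = Xt (s, t, \<theta>)"
  unfolding D_time_def
  using vector_derivative_within_cbox[OF ab, of t] deriv_t[OF smooth_X, of s t \<theta>]
  by (simp add: X_def)

lemma D_ang_V: "s \<in> I \<Longrightarrow> t \<in> J \<Longrightarrow> D_ang (V s t) \<theta> = Xh (s, t, \<theta>)"
  unfolding D_ang_def
  using vector_derivative_at[OF deriv_h[OF smooth_X, of s t \<theta>]] by (simp add: X_def)

lemma V_Imm: "s \<in> I \<Longrightarrow> t \<in> J \<Longrightarrow> V s t \<in> Imm"
  using var unfolding fixed_endpoint_variation_def by blast

lemma Xh_nonzero [simp]: "s \<in> I \<Longrightarrow> t \<in> J \<Longrightarrow> Xh (s, t, \<theta>) \<noteq> 0"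
  using V_Imm[of s t] D_ang_V[of s t \<theta>] unfolding Imm_def D_ang_def by auto

definition periodic :: "(real \<times> real \<times> real \<Rightarrow> 'b) \<Rightarrow> bool" where
  "periodic f \<longleftrightarrow> (\<forall>s\<in>I. \<forall>t\<in>J. \<forall>\<theta>. f (s, t, \<theta> + 2 * pi) = f (s, t, \<theta>))"

lemma periodic_X: "periodic X"
  using V_Imm unfolding periodic_def X_def Imm_def by auto

lemma periodic_partial:
  assumes f: "smooth_on slab f" and per: "periodic f"
  shows "periodic (Ds f)" "periodic (Dt f)" "periodic (Dh f)"
proof -
  have eq: "f (s, t, \<theta> + 2 * pi) = f (s, t, \<theta>)" if "s \<in> I" "t \<in> J" for s t \<theta>
    using per that unfolding periodic_def by blast
  show "periodic (Ds f)" unfolding periodic_def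
  proof (intro ballI allI)
    fix s t \<theta> assume st: "s \<in> I" "t \<in> J"
    have "((\<lambda>s. f (s, t, \<theta>)) has_vector_derivative Ds f (s, t, \<theta> + 2 * pi)) (at s within I)"
      by (rule has_vector_derivative_transform[OF st(1) _ deriv_s[OF f st]]) (use st in \<open>auto simp: eq\<close>)
    then show "Ds f (s, t, \<theta> + 2 * pi) = Ds f (s, t, \<theta>)"
      using uniq_s[OF st(1)] deriv_s[OF f st] by blast
  qed
  show "periodic (Dt f)" unfolding periodic_def
  proof (intro ballI allI)
    fix s t \<theta> assume st: "s \<in> I" "t \<in> J"
    have "((\<lambda>t. f (s, t, \<theta>)) has_vector_derivative Dt f (s, t, \<theta> + 2 * pi)) (at t within J)"
      by (rule has_vector_derivative_transform[OF st(2) _ deriv_t[OF f st]]) (use st in \<open>auto simp: eq\<close>)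
    then show "Dt f (s, t, \<theta> + 2 * pi) = Dt f (s, t, \<theta>)"
      using uniq_t[OF st(2)] deriv_t[OF f st] by blast
  qed
  show "periodic (Dh f)" unfolding periodic_def
  proof (intro ballI allI)
    fix s t \<theta> assume st: "s \<in> I" "t \<in> J"
    have "((\<lambda>\<theta>. \<theta> + 2 * pi) has_vector_derivative 1) (at \<theta>)"
      by (auto intro!: derivative_eq_intros simp: has_vector_derivative_def)
    from vector_diff_chain_at[OF this deriv_h[OF f st]]
    have "((\<lambda>\<theta>. f (s, t, \<theta>)) has_vector_derivative Dh f (s, t, \<theta> + 2 * pi)) (at \<theta>)"
      by (simp add: o_def eq[OF st])
    then show "Dh f (s, t, \<theta> + 2 * pi) = Dh f (s, t, \<theta>)"
      by (rule vector_derivative_unique_at[OF _ deriv_h[OF f st]])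
  qed
qed


section \<open>Length and kinetic integral along a variation\<close>

lemma slab_cases: "x \<in> slab \<Longrightarrow> (\<And>s t \<theta>. x = (s, t, \<theta>) \<Longrightarrow> s \<in> I \<Longrightarrow> t \<in> J \<Longrightarrow> P) \<Longrightarrow> P"
  by (cases x) auto

lemma Xh_nonzero': "x \<in> slab \<Longrightarrow> Xh x \<noteq> 0"
  by (erule slab_cases) simp

lemmas continuous_partials [continuous_intros] =
  continuous_partial[OF smooth_X]
  continuous_partial[OF smooth_on_partial[OF smooth_X]]
  continuous_partial[OF smooth_on_partial[OF smooth_on_partial[OF smooth_X]]]

lemma continuous_line_h:
  assumes "continuous_on slab f" "s \<in> I" "t \<in> J"
  shows "continuous_on A (\<lambda>\<theta>. f (s, t, \<theta>))"
  by (rule continuous_on_compose2[OF assms(1)]) (use assms in \<open>auto intro!: continuous_intros\<close>)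

lemma continuous_angle_integral:
  fixes f :: "real \<times> real \<times> real \<Rightarrow> 'b::banach"
  assumes f: "continuous_on slab f" and p: "continuous_on A p" "continuous_on A q" "\<And>x. x \<in> A \<Longrightarrow> p x \<in> I \<and> q x \<in> J"
  shows "continuous_on A (\<lambda>x. integral {0..2 * pi} (\<lambda>\<theta>. f (p x, q x, \<theta>)))"
proof -
  have "continuous_on A (\<lambda>x. (p x, q x))" by (intro continuous_intros p)
  moreover have "(\<lambda>x. (p x, q x)) ` A \<subseteq> I \<times> J" using p(3) by blast
  ultimately show ?thesis
    using continuous_on_compose2[OF continuous_on_param_integral[OF f[unfolded slab_def]]] by force
qed

lemma leibniz_s:
  fixes f f' :: "real \<times> real \<times> real \<Rightarrow> real"
  assumes d: "\<And>s t \<theta>. s \<in> I \<Longrightarrow> t \<in> J \<Longrightarrow> ((\<lambda>s. f (s, t, \<theta>)) has_real_derivative f' (s, t, \<theta>)) (at s within I)"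
    and f: "continuous_on slab f" and f': "continuous_on slab f'" and st: "s \<in> I" "t \<in> J"
  shows "((\<lambda>s. integral {0..2 * pi} (\<lambda>\<theta>. f (s, t, \<theta>))) has_real_derivative
           integral {0..2 * pi} (\<lambda>\<theta>. f' (s, t, \<theta>))) (at s within I)"
proof -
  have "continuous_on (I \<times> cbox 0 (2 * pi)) (\<lambda>(s, \<theta>). f' (s, t, \<theta>))"
    unfolding case_prod_beta
    by (rule continuous_on_compose2[OF f']) (use st in \<open>auto intro!: continuous_intros\<close>)
  from leibniz_rule_field_derivative[OF d _ this st(1)] continuous_line_h[OF f _ st(2)] st
  show ?thesis by (simp add: integrable_continuous_real)
qed

lemma leibniz_t:
  fixes f f' :: "real \<times> real \<times> real \<Rightarrow> real"
  assumes d: "\<And>s t \<theta>. s \<in> I \<Longrightarrow> t \<in> J \<Longrightarrow> ((\<lambda>t. f (s, t, \<theta>)) has_real_derivative f' (s, t, \<theta>)) (at t within J)"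
    and f: "continuous_on slab f" and f': "continuous_on slab f'" and st: "s \<in> I" "t \<in> J"
  shows "((\<lambda>t. integral {0..2 * pi} (\<lambda>\<theta>. f (s, t, \<theta>))) has_real_derivative
           integral {0..2 * pi} (\<lambda>\<theta>. f' (s, t, \<theta>))) (at t within J)"
proof -
  have "continuous_on (J \<times> cbox 0 (2 * pi)) (\<lambda>(t, \<theta>). f' (s, t, \<theta>))"
    unfolding case_prod_beta
    by (rule continuous_on_compose2[OF f']) (use st in \<open>auto intro!: continuous_intros\<close>)
  from leibniz_rule_field_derivative[OF d _ this st(2)] continuous_line_h[OF f st(1)] st
  show ?thesis by (simp add: integrable_continuous_real)
qed

text \<open>Besides the length, the energy density contains \<open>kin\<close>, the integral \<open>\<integral> |c\<^sub>t|\<^sup>2 |c\<^sub>\<theta>| d\<theta>\<close>, which is the squared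
velocity before the conformal factor \<open>\<phi>(\<ell>)\<close> is applied. The suffixed quantities are their
formal derivatives in \<open>s\<close> and \<open>t\<close>, as \<open>deriv_len_s\<close>, \<open>deriv_len_t\<close> and \<open>deriv_kin_s\<close> confirm.\<close>
definition "len s t = integral {0..2 * pi} (\<lambda>\<theta>. norm (Xh (s, t, \<theta>)))"
definition "len_s s t = integral {0..2 * pi} (\<lambda>\<theta>. Xh (s, t, \<theta>) \<bullet> Ds Xh (s, t, \<theta>) / norm (Xh (s, t, \<theta>)))"
definition "len_t s t = integral {0..2 * pi} (\<lambda>\<theta>. Xh (s, t, \<theta>) \<bullet> Dt Xh (s, t, \<theta>) / norm (Xh (s, t, \<theta>)))"
definition "kin s t = integral {0..2 * pi} (\<lambda>\<theta>. (Xt (s, t, \<theta>) \<bullet> Xt (s, t, \<theta>)) * norm (Xh (s, t, \<theta>)))"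
definition "kin_s s t = integral {0..2 * pi} (\<lambda>\<theta>.
  (Xt (s, t, \<theta>) \<bullet> Xt (s, t, \<theta>)) * (Xh (s, t, \<theta>) \<bullet> Ds Xh (s, t, \<theta>) / norm (Xh (s, t, \<theta>)))
   + (Xt (s, t, \<theta>) \<bullet> Ds Xt (s, t, \<theta>) + Ds Xt (s, t, \<theta>) \<bullet> Xt (s, t, \<theta>)) * norm (Xh (s, t, \<theta>)))"

lemma continuous_len_kin [continuous_intros]:
  assumes "continuous_on A p" "continuous_on A q" "\<And>x. x \<in> A \<Longrightarrow> p x \<in> I \<and> q x \<in> J"
  shows "continuous_on A (\<lambda>x. len (p x) (q x))" "continuous_on A (\<lambda>x. len_s (p x) (q x))"
    "continuous_on A (\<lambda>x. len_t (p x) (q x))" "continuous_on A (\<lambda>x. kin (p x) (q x))"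
    "continuous_on A (\<lambda>x. kin_s (p x) (q x))"
proof -
  have "continuous_on slab (\<lambda>x. norm (Xh x))"
    "continuous_on slab (\<lambda>x. Xh x \<bullet> Ds Xh x / norm (Xh x))"
    "continuous_on slab (\<lambda>x. Xh x \<bullet> Dt Xh x / norm (Xh x))"
    "continuous_on slab (\<lambda>x. (Xt x \<bullet> Xt x) * norm (Xh x))"
    "continuous_on slab (\<lambda>x. (Xt x \<bullet> Xt x) * (Xh x \<bullet> Ds Xh x / norm (Xh x))
      + (Xt x \<bullet> Ds Xt x + Ds Xt x \<bullet> Xt x) * norm (Xh x))"
    by (intro continuous_intros; simp add: Xh_nonzero')+
  from this[THEN continuous_angle_integral, OF assms]
  show "continuous_on A (\<lambda>x. len (p x) (q x))" "continuous_on A (\<lambda>x. len_s (p x) (q x))"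
    "continuous_on A (\<lambda>x. len_t (p x) (q x))" "continuous_on A (\<lambda>x. kin (p x) (q x))"
    "continuous_on A (\<lambda>x. kin_s (p x) (q x))"
    unfolding len_def len_s_def len_t_def kin_def kin_s_def by simp_all
qed

lemma len_pos:
  assumes "s \<in> I" "t \<in> J"
  shows "len s t > 0"
proof -
  have c: "continuous_on {0..2 * pi} (\<lambda>\<theta>. norm (Xh (s, t, \<theta>)))"
    by (intro continuous_intros) (use assms in auto)
  have "len s t \<noteq> 0"
    unfolding len_def using integral_eq_0_iff[OF c] assms pi_gt_zero by auto
  moreover have "len s t \<ge> 0" unfolding len_def by (rule integral_nonneg) (auto intro!: integrable_continuous_real c)
  ultimately show ?thesis by simp
qed

lemma deriv_len_s: "s \<in> I \<Longrightarrow> t \<in> J \<Longrightarrow> ((\<lambda>s. len s t) has_real_derivative len_s s t) (at s within I)"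
  unfolding len_def len_s_def
  by (rule leibniz_s[where f = "\<lambda>x. norm (Xh x)" and f' = "\<lambda>x. Xh x \<bullet> Ds Xh x / norm (Xh x)"])
     (auto intro!: continuous_intros has_real_derivative_norm deriv_s smooth_intros simp: Xh_nonzero')

lemma deriv_len_t: "s \<in> I \<Longrightarrow> t \<in> J \<Longrightarrow> ((\<lambda>t. len s t) has_real_derivative len_t s t) (at t within J)"
  unfolding len_def len_t_def
  by (rule leibniz_t[where f = "\<lambda>x. norm (Xh x)" and f' = "\<lambda>x. Xh x \<bullet> Dt Xh x / norm (Xh x)"])
     (auto intro!: continuous_intros has_real_derivative_norm deriv_t smooth_intros simp: Xh_nonzero')

lemma deriv_kin_s: "s \<in> I \<Longrightarrow> t \<in> J \<Longrightarrow> ((\<lambda>s. kin s t) has_real_derivative kin_s s t) (at s within I)"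
  unfolding kin_def kin_s_def
  by (rule leibniz_s[where f = "\<lambda>x. (Xt x \<bullet> Xt x) * norm (Xh x)"
        and f' = "\<lambda>x. (Xt x \<bullet> Xt x) * (Xh x \<bullet> Ds Xh x / norm (Xh x)) + (Xt x \<bullet> Ds Xt x + Ds Xt x \<bullet> Xt x) * norm (Xh x)"];
      (intro continuous_intros DERIV_mult' has_real_derivative_norm has_real_derivative_inner deriv_s smooth_intros)?;
      (auto simp: Xh_nonzero')?)

lemma \<phi>_deriv: "0 < l \<Longrightarrow> (\<phi> has_real_derivative deriv \<phi> l) (at l within A)"
proof -
  assume l: "0 < l"
  then have "\<phi> differentiable (at l)"
    using smooth_on_has_derivative[OF \<phi>, of l] at_within_open[of l "{0<..}"]
    by (auto simp: differentiable_def)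
  then show ?thesis
    by (metis DERIV_deriv_iff_real_differentiable has_field_derivative_at_within)
qed

lemma continuous_deriv_\<phi>: "continuous_on {0<..} (deriv \<phi>)"
proof -
  have "continuous_on {0<..} (\<lambda>l. frechet_derivative \<phi> (at l within {0<..}) 1)"
    by (intro smooth_on_continuous smooth_on_frechet \<phi>)
  moreover have "frechet_derivative \<phi> (at l within {0<..}) 1 = deriv \<phi> l" if "0 < l" for l
  proof -
    have "(\<phi> has_derivative (*) (deriv \<phi> l)) (at l)"
      using \<phi>_deriv[OF that, of UNIV] by (simp add: has_field_derivative_def)
    then have "frechet_derivative \<phi> (at l) = (*) (deriv \<phi> l)"
      by (rule frechet_derivative_at[symmetric])
    then show ?thesis using at_within_open[of l "{0<..}"] that by simp
  qed
  ultimately show ?thesis by (rule continuous_on_eq) simp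
qed

lemma \<phi>_continuous [continuous_intros]:
  assumes "continuous_on A f" "\<And>x. x \<in> A \<Longrightarrow> 0 < f x"
  shows "continuous_on A (\<lambda>x. \<phi> (f x))" "continuous_on A (\<lambda>x. deriv \<phi> (f x))"
  using continuous_on_compose2[OF smooth_on_continuous[OF \<phi>] assms(1)]
    continuous_on_compose2[OF continuous_deriv_\<phi> assms(1)] assms(2) by auto

end

section \<open>The first variation of the energy\<close>

definition geodesic_defect :: "(real \<Rightarrow> real) \<Rightarrow> real \<Rightarrow> real \<Rightarrow> (real \<Rightarrow> real \<Rightarrow> complex) \<Rightarrow> real \<Rightarrow> real \<Rightarrow> complex" where
  "geodesic_defect \<phi> a b c t \<theta> =
    D_time a b (\<lambda>\<tau> \<eta>. (\<phi> (curve_length (c \<tau>)) * norm (D_ang (c \<tau>) \<eta>)) *\<^sub>R D_time a b c \<tau> \<eta>) t \<theta>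
    + (1 / 2) *
         (of_real (integral {0..2 * pi} (\<lambda>\<eta>. (norm (D_time a b c t \<eta>))\<^sup>2 * norm (D_ang (c t) \<eta>)))
            * \<i> * of_real (deriv \<phi> (curve_length (c t)))
            * of_real (curvature (c t) \<theta>) * D_ang (c t) \<theta>
          + of_real (\<phi> (curve_length (c t)))
            * D_ang (\<lambda>\<eta>. ((norm (D_time a b c t \<eta>))\<^sup>2 / norm (D_ang (c t) \<eta>)) *\<^sub>R D_ang (c t) \<eta>) \<theta>)"

context curve_variation
begin

lemma curve_length_V: "s \<in> I \<Longrightarrow> t \<in> J \<Longrightarrow> curve_length (V s t) = len s t"
  unfolding curve_length_def len_def by (simp add: D_ang_V)

lemma energy_V:
  assumes "s \<in> I"
  shows "energy \<phi> a b (V s) = 1 / 2 * integral J (\<lambda>t. \<phi> (len s t) * kin s t)"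
proof -
  have "integral J (\<lambda>t. conf_metric \<phi> (V s t) (D_time a b (V s) t) (D_time a b (V s) t)) =
        integral J (\<lambda>t. \<phi> (len s t) * kin s t)"
    by (rule integral_cong)
       (simp add: conf_metric_def curve_length_V D_time_V D_ang_V kin_def assms del: greaterThanLessThan_iff atLeastAtMost_iff)
  then show ?thesis by (simp add: energy_def)
qed

definition "energy_rate s t = \<phi> (len s t) * kin_s s t + (deriv \<phi> (len s t) * len_s s t) * kin s t"

lemma deriv_energy:
  "((\<lambda>s. energy \<phi> a b (V s)) has_real_derivative 1 / 2 * integral J (energy_rate 0)) (at 0)"
proof -
  have d: "((\<lambda>s. \<phi> (len s t) * kin s t) has_real_derivative energy_rate s t) (at s within I)"
    if "s \<in> I" "t \<in> J" for s t
    unfolding energy_rate_def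
    by (intro DERIV_mult' deriv_kin_s deriv_len_s DERIV_chain2[OF \<phi>_deriv] len_pos that)
  have ci: "(\<lambda>t. \<phi> (len s t) * kin s t) integrable_on cbox a b" if "s \<in> I" for s
    unfolding cbox_interval
    by (intro integrable_continuous_real continuous_intros len_pos) (use that in auto)
  have cr: "continuous_on (I \<times> cbox a b) (\<lambda>(s, t). energy_rate s t)"
    unfolding case_prod_beta energy_rate_def
    by (intro continuous_intros len_pos) auto
  have "((\<lambda>s. integral (cbox a b) (\<lambda>t. \<phi> (len s t) * kin s t)) has_real_derivative
      integral (cbox a b) (energy_rate 0)) (at 0 within I)"
    by (rule leibniz_rule_field_derivative[OF d ci cr]) (use \<epsilon> in auto)
  then have "((\<lambda>s. 1 / 2 * integral J (\<lambda>t. \<phi> (len s t) * kin s t)) has_real_derivative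
      1 / 2 * integral J (energy_rate 0)) (at 0 within I)"
    unfolding cbox_interval by (rule DERIV_cmult)
  then have "((\<lambda>s. energy \<phi> a b (V s)) has_real_derivative 1 / 2 * integral J (energy_rate 0)) (at 0 within I)"
    unfolding has_real_derivative_iff_has_vector_derivative
    by (rule has_vector_derivative_transform[OF zero_in_I, rotated]) (rule energy_V)
  then show ?thesis using at_within_open[of 0 I] \<epsilon> by simp
qed

text \<open>The fields that are paired with the derivatives of \<open>Xs\<close>: the unit tangent \<open>Tan\<close> and its multiple
\<open>Str\<close> by \<open>|c\<^sub>t|\<^sup>2\<close> with \<open>\<partial>\<^sub>\<theta> Xs\<close>, and the momentum density \<open>Mom\<close> with \<open>\<partial>\<^sub>t Xs\<close>. Integration by parts
replaces them by their derivatives \<open>Tan_h\<close>, \<open>Str_h\<close> and \<open>Mom_t\<close>, whose combination \<open>Grad\<close> is the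
\<open>L\<^sup>2\<close> gradient of the energy.\<close>
definition "Tan x = inverse (norm (Xh x)) *\<^sub>R Xh x"
definition "Tan_h x = inverse (norm (Xh x)) *\<^sub>R Dh Xh x +
  (- (inverse (norm (Xh x)) * (Xh x \<bullet> Dh Xh x / norm (Xh x)) * inverse (norm (Xh x)))) *\<^sub>R Xh x"
definition "Str x = (Xt x \<bullet> Xt x) *\<^sub>R Tan x"
definition "Str_h x = (Xt x \<bullet> Xt x) *\<^sub>R Tan_h x + (Xt x \<bullet> Dh Xt x + Dh Xt x \<bullet> Xt x) *\<^sub>R Tan x"
definition "Mom x = (\<phi> (len (fst x) (fst (snd x))) * norm (Xh x)) *\<^sub>R Xt x"
definition "Mom_t x =
  (\<phi> (len (fst x) (fst (snd x))) * norm (Xh x)) *\<^sub>R Dt Xt x +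
  (\<phi> (len (fst x) (fst (snd x))) * (Xh x \<bullet> Dt Xh x / norm (Xh x)) +
   (deriv \<phi> (len (fst x) (fst (snd x))) * len_t (fst x) (fst (snd x))) * norm (Xh x)) *\<^sub>R Xt x"
definition "Grad x =
  - (1 / 2 * deriv \<phi> (len (fst x) (fst (snd x))) * kin (fst x) (fst (snd x))) *\<^sub>R Tan_h x
  - (1 / 2 * \<phi> (len (fst x) (fst (snd x)))) *\<^sub>R Str_h x - Mom_t x"

lemma deriv_Tan_h:
  assumes "s \<in> I" "t \<in> J"
  shows "((\<lambda>\<theta>. Tan (s, t, \<theta>)) has_vector_derivative Tan_h (s, t, \<theta>)) (at \<theta>)"
  unfolding Tan_def Tan_h_def
  by (intro has_vector_derivative_scaleR DERIV_inverse' has_real_derivative_norm deriv_h smooth_intros assms)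
     (use assms in auto)

lemma deriv_Str_h:
  assumes "s \<in> I" "t \<in> J"
  shows "((\<lambda>\<theta>. Str (s, t, \<theta>)) has_vector_derivative Str_h (s, t, \<theta>)) (at \<theta>)"
  unfolding Str_def Str_h_def
  by (intro has_vector_derivative_scaleR has_real_derivative_inner deriv_h smooth_intros assms deriv_Tan_h)

lemma deriv_Mom_t:
  assumes "s \<in> I" "t \<in> J"
  shows "((\<lambda>t. Mom (s, t, \<theta>)) has_vector_derivative Mom_t (s, t, \<theta>)) (at t within J)"
  unfolding Mom_def Mom_t_def fst_conv snd_conv
  by (intro has_vector_derivative_scaleR DERIV_mult' DERIV_chain2[OF \<phi>_deriv] has_real_derivative_norm
        deriv_t deriv_len_t smooth_intros assms len_pos)
     (use assms in auto)

lemma continuous_fields: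
  "continuous_on slab Tan" "continuous_on slab Tan_h" "continuous_on slab Str" "continuous_on slab Str_h"
  "continuous_on slab Mom" "continuous_on slab Mom_t" "continuous_on slab Grad"
proof -
  have l: "fst x \<in> I \<and> fst (snd x) \<in> J" "0 < len (fst x) (fst (snd x))" "norm (Xh x) \<noteq> 0"
    if "x \<in> slab" for x
    using that by (auto elim!: slab_cases simp: len_pos)
  show 1: "continuous_on slab Tan" "continuous_on slab Tan_h"
    unfolding Tan_def[abs_def] Tan_h_def[abs_def]
    by (intro continuous_intros ballI l; simp)+
  show 2: "continuous_on slab Str" "continuous_on slab Str_h"
    unfolding Str_def[abs_def] Str_h_def[abs_def]
    by (intro continuous_intros 1; simp)+
  show 3: "continuous_on slab Mom" "continuous_on slab Mom_t"
    unfolding Mom_def[abs_def] Mom_t_def[abs_def]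
    by (intro continuous_intros ballI l; simp)+
  show "continuous_on slab Grad"
    unfolding Grad_def[abs_def]
    by (intro continuous_intros ballI l 1 2 3; simp)
qed

lemma periodic_fields: "periodic Xs" "periodic Tan" "periodic Str" "periodic Grad"
proof -
  note p = periodic_X periodic_partial[OF smooth_X periodic_X]
  note pp = p periodic_partial[OF smooth_on_partial[OF smooth_X] p(3)]
    periodic_partial[OF smooth_on_partial[OF smooth_X] p(4)]
  show "periodic Xs" "periodic Tan" "periodic Str" "periodic Grad"
    using pp unfolding periodic_def Tan_def Str_def Grad_def Tan_h_def Str_h_def Mom_t_def by auto
qed

text \<open>The curve is closed, so both ends of the interval of angles contribute the same boundary term.\<close>
lemma angle_by_parts:
  assumes st: "s \<in> I" "t \<in> J"
    and f: "\<And>\<theta>. ((\<lambda>\<theta>. f (s, t, \<theta>)) has_vector_derivative f' (s, t, \<theta>)) (at \<theta>)"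
    and "periodic f" "continuous_on slab f'"
  shows "integral {0..2 * pi} (\<lambda>\<theta>. f (s, t, \<theta>) \<bullet> Ds Xh (s, t, \<theta>)) =
       - integral {0..2 * pi} (\<lambda>\<theta>. f' (s, t, \<theta>) \<bullet> Xs (s, t, \<theta>))"
proof (rule integral_by_parts_boundary_free)
  have "f (s, t, 0 + 2 * pi) = f (s, t, 0)" "Xs (s, t, 0 + 2 * pi) = Xs (s, t, 0)"
    using assms(4) periodic_fields(1) st unfolding periodic_def by blast+
  then show "f (s, t, 2 * pi) \<bullet> Xs (s, t, 2 * pi) = f (s, t, 0) \<bullet> Xs (s, t, 0)" by simp
  show "continuous_on {0..2 * pi} (\<lambda>\<theta>. f' (s, t, \<theta>))" "continuous_on {0..2 * pi} (\<lambda>\<theta>. Ds Xh (s, t, \<theta>))"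
    by (intro continuous_line_h assms smooth_on_continuous smooth_intros)+
qed (auto intro: has_vector_derivative_at_within f deriv_Xs_h[OF st])

text \<open>Integration by parts in time is performed on the pairing of the momentum with \<open>Xs\<close>, as a function of
\<open>t\<close> alone; this avoids an exchange of the two integrals.\<close>
definition "pairing t = integral {0..2 * pi} (\<lambda>\<theta>. Mom (0, t, \<theta>) \<bullet> Xs (0, t, \<theta>))"
definition "pairing_t t = integral {0..2 * pi}
  (\<lambda>\<theta>. Mom (0, t, \<theta>) \<bullet> Ds Xt (0, t, \<theta>) + Mom_t (0, t, \<theta>) \<bullet> Xs (0, t, \<theta>))"

lemma deriv_pairing:
  assumes "t \<in> J"
  shows "(pairing has_real_derivative pairing_t t) (at t within J)"
proof -
  have "continuous_on slab (\<lambda>x. Mom x \<bullet> Xs x)" "continuous_on slab (\<lambda>x. Mom x \<bullet> Ds Xt x + Mom_t x \<bullet> Xs x)"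
    by (intro continuous_intros continuous_fields; simp)+
  then show ?thesis
    unfolding pairing_def pairing_t_def
    by (intro leibniz_t[where f = "\<lambda>x. Mom x \<bullet> Xs x"] has_real_derivative_inner deriv_Mom_t deriv_Xs_t
          zero_in_I assms)
qed

lemma Xs_endpoint:
  assumes "t = a \<or> t = b"
  shows "Xs (0, t, \<theta>) = 0"
proof -
  have t: "t \<in> J" using assms ab by auto
  have eq: "V s t = c t" if "s \<in> I" for s
    using var assms that unfolding fixed_endpoint_variation_def by blast
  have "((\<lambda>s. X (s, t, \<theta>)) has_vector_derivative 0) (at 0 within I)"
    by (rule has_vector_derivative_transform[where f = "\<lambda>s. c t \<theta>"])
       (use eq in \<open>auto simp: X_def \<epsilon>\<close>)
  then show ?thesis
    using uniq_s[OF zero_in_I deriv_s[OF smooth_X zero_in_I t]] by blast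
qed

lemma integral_pairing_t: "integral J pairing_t = 0"
proof -
  have "(pairing_t has_integral (pairing b - pairing a)) J"
    by (rule fundamental_theorem_of_calculus)
       (use ab deriv_pairing in \<open>auto simp: has_real_derivative_iff_has_vector_derivative\<close>)
  moreover have "pairing a = 0" "pairing b = 0"
    unfolding pairing_def by (simp_all add: Xs_endpoint)
  ultimately show ?thesis by (simp add: integral_unique)
qed

text \<open>At each time the energy density changes at the rate given by \<open>Grad\<close>, up to the total time derivative
\<open>pairing_t\<close>. The length contributes through \<open>\<phi>'(\<ell>) \<ell>\<^sub>s\<close> with \<open>\<ell>\<^sub>s = - \<integral> Tan_h \<bullet> Xs\<close>, and \<open>kin_s\<close> contributes
through \<open>Str_h\<close> and the momentum.\<close>
lemma energy_rate_eq:
  assumes t: "t \<in> J"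
  shows "1 / 2 * energy_rate 0 t =
    integral {0..2 * pi} (\<lambda>\<theta>. Grad (0, t, \<theta>) \<bullet> Xs (0, t, \<theta>)) + pairing_t t"
proof -
  note st = zero_in_I t
  let ?i = "\<lambda>f. integral {0..2 * pi} (\<lambda>\<theta>. f (0, t, \<theta>) :: real)"
  have int: "(\<lambda>\<theta>. f (0, t, \<theta>)) integrable_on {0..2 * pi}" if "continuous_on slab f" for f :: "_ \<Rightarrow> real"
    by (intro integrable_continuous_real continuous_line_h that st)
  define P where "P = ?i (\<lambda>x. Tan_h x \<bullet> Xs x)"
  define Q where "Q = ?i (\<lambda>x. Str_h x \<bullet> Xs x)"
  define R where "R = ?i (\<lambda>x. Mom_t x \<bullet> Xs x)"
  define K where "K = ?i (\<lambda>x. Mom x \<bullet> Ds Xt x)"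
  define l where "l = len 0 t"
  have c: "continuous_on slab (\<lambda>x. Tan_h x \<bullet> Xs x)" "continuous_on slab (\<lambda>x. Str_h x \<bullet> Xs x)"
    "continuous_on slab (\<lambda>x. Mom_t x \<bullet> Xs x)" "continuous_on slab (\<lambda>x. Mom x \<bullet> Ds Xt x)"
    "continuous_on slab (\<lambda>x. Str x \<bullet> Ds Xh x)" "continuous_on slab (\<lambda>x. norm (Xh x) * (Xt x \<bullet> Ds Xt x))"
    by (intro continuous_intros continuous_fields; simp)+
  note I = c[THEN int]
  have "len_s 0 t = ?i (\<lambda>x. Tan x \<bullet> Ds Xh x)"
    unfolding len_s_def by (rule integral_cong) (simp add: Tan_def divide_inverse)
  also have "\<dots> = - P"
    unfolding P_def by (intro angle_by_parts[OF st] deriv_Tan_h st continuous_fields periodic_fields)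
  finally have len: "len_s 0 t = - P" .
  have "kin_s 0 t = integral {0..2 * pi} (\<lambda>\<theta>. Str (0, t, \<theta>) \<bullet> Ds Xh (0, t, \<theta>)
      + 2 * (norm (Xh (0, t, \<theta>)) * (Xt (0, t, \<theta>) \<bullet> Ds Xt (0, t, \<theta>))))"
    unfolding kin_s_def
    by (rule integral_cong) (simp add: Str_def Tan_def divide_inverse inner_commute[of "Ds Xt _"])
  also have "\<dots> = ?i (\<lambda>x. Str x \<bullet> Ds Xh x) + 2 * ?i (\<lambda>x. norm (Xh x) * (Xt x \<bullet> Ds Xt x))"
    by (subst integral_add) (auto intro!: I integrable_on_cmult_left)
  also have "?i (\<lambda>x. Str x \<bullet> Ds Xh x) = - Q"
    unfolding Q_def by (intro angle_by_parts[OF st] deriv_Str_h st continuous_fields periodic_fields)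
  finally have kin: "kin_s 0 t = - Q + 2 * ?i (\<lambda>x. norm (Xh x) * (Xt x \<bullet> Ds Xt x))" .
  have K: "\<phi> l * ?i (\<lambda>x. norm (Xh x) * (Xt x \<bullet> Ds Xt x)) = K"
    unfolding K_def by (simp add: Mom_def l_def mult.assoc flip: integral_mult_right)
  have "pairing_t t = K + R"
    unfolding pairing_t_def K_def R_def by (intro integral_add I)
  moreover have "?i (\<lambda>x. Grad x \<bullet> Xs x) = - (1 / 2 * deriv \<phi> l * kin 0 t) * P - (1 / 2 * \<phi> l) * Q - R"
  proof -
    have "?i (\<lambda>x. Grad x \<bullet> Xs x) = integral {0..2 * pi} (\<lambda>\<theta>.
       - (1 / 2 * deriv \<phi> l * kin 0 t) * (Tan_h (0, t, \<theta>) \<bullet> Xs (0, t, \<theta>))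
       - (1 / 2 * \<phi> l) * (Str_h (0, t, \<theta>) \<bullet> Xs (0, t, \<theta>)) - Mom_t (0, t, \<theta>) \<bullet> Xs (0, t, \<theta>))"
      by (rule integral_cong) (simp add: Grad_def l_def inner_diff_left)
    also have "\<dots> = - (1 / 2 * deriv \<phi> l * kin 0 t) * P - (1 / 2 * \<phi> l) * Q - R"
      unfolding P_def Q_def R_def
      by (intro integral_unique has_integral_diff has_integral_mult_right integrable_integral I)
    finally show ?thesis .
  qed
  moreover have "1 / 2 * energy_rate 0 t = 1 / 2 * (\<phi> l * - Q + deriv \<phi> l * - P * kin 0 t) + K"
    unfolding energy_rate_def len kin K[symmetric] l_def by (simp add: algebra_simps)
  ultimately show ?thesis by (simp add: algebra_simps)
qed

theorem first_variation:
  "((\<lambda>s. energy \<phi> a b (V s)) has_real_derivative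
     integral J (\<lambda>t. integral {0..2 * pi} (\<lambda>\<theta>. Grad (0, t, \<theta>) \<bullet> Xs (0, t, \<theta>)))) (at 0)"
proof -
  have c: "continuous_on slab (\<lambda>x. Grad x \<bullet> Xs x)" "continuous_on slab (\<lambda>x. Mom x \<bullet> Ds Xt x + Mom_t x \<bullet> Xs x)"
    by (intro continuous_intros continuous_fields; simp)+
  have "1 / 2 * integral J (energy_rate 0) = integral J (\<lambda>t. 1 / 2 * energy_rate 0 t)"
    by (simp only: integral_mult_right)
  also have "\<dots> = integral J (\<lambda>t. integral {0..2 * pi} (\<lambda>\<theta>. Grad (0, t, \<theta>) \<bullet> Xs (0, t, \<theta>)) + pairing_t t)"
    by (rule integral_cong) (rule energy_rate_eq)
  also have "\<dots> = integral J (\<lambda>t. integral {0..2 * pi} (\<lambda>\<theta>. Grad (0, t, \<theta>) \<bullet> Xs (0, t, \<theta>))) + integral J pairing_t"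
    unfolding pairing_t_def
    by (intro integral_add integrable_continuous_real continuous_angle_integral[OF c(1)]
          continuous_angle_integral[OF c(2)])
       (use \<epsilon> in \<open>auto intro!: continuous_intros\<close>)
  finally show ?thesis
    using deriv_energy by (simp add: integral_pairing_t)
qed

lemma D_time_eqI:
  "t \<in> J \<Longrightarrow> ((\<lambda>\<tau>. f \<tau> \<theta>) has_vector_derivative d) (at t within J) \<Longrightarrow> D_time a b f t \<theta> = d"
  unfolding D_time_def by (rule vector_derivative_within_closed_interval[OF ab])

lemma D_time_c: "t \<in> J \<Longrightarrow> D_time a b c t \<theta> = Xt (0, t, \<theta>)"
proof -
  assume t: "t \<in> J"
  have "((\<lambda>t. c t \<theta>) has_vector_derivative Xt (0, t, \<theta>)) (at t within J)"
    by (rule has_vector_derivative_transform[OF t _ deriv_t[OF smooth_X zero_in_I t]])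
       (use var in \<open>auto simp: X_def fixed_endpoint_variation_def\<close>)
  then show ?thesis by (rule D_time_eqI[OF t])
qed

lemma V_0: "t \<in> J \<Longrightarrow> V 0 t = c t"
  using var by (simp add: fixed_endpoint_variation_def)

lemma D_ang_c: "t \<in> J \<Longrightarrow> D_ang (c t) \<theta> = Xh (0, t, \<theta>)"
  using D_ang_V[OF zero_in_I] V_0 by metis

text \<open>The curvature term of the equation is the derivative of the unit tangent, by \<open>curvature_eqn\<close>; after
this substitution both sides are the same expression.\<close>
lemma geodesic_defect_eq:
  assumes t: "t \<in> J"
  shows "geodesic_defect \<phi> a b c t \<theta> = - Grad (0, t, \<theta>)"
proof -
  note st = zero_in_I t
  have len: "curve_length (c t) = len 0 t" if "t \<in> J" for t
    using curve_length_V[OF zero_in_I that] V_0[OF that] by simp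
  have "((\<lambda>\<tau>. (\<phi> (curve_length (c \<tau>)) * norm (D_ang (c \<tau>) \<theta>)) *\<^sub>R D_time a b c \<tau> \<theta>)
      has_vector_derivative Mom_t (0, t, \<theta>)) (at t within J)"
    by (rule has_vector_derivative_transform[OF t _ deriv_Mom_t[OF st]])
       (simp only: len D_ang_c D_time_c Mom_def fst_conv snd_conv)
  then have 1: "D_time a b (\<lambda>\<tau> \<eta>. (\<phi> (curve_length (c \<tau>)) * norm (D_ang (c \<tau>) \<eta>)) *\<^sub>R D_time a b c \<tau> \<eta>) t \<theta>
      = Mom_t (0, t, \<theta>)"
    by (rule D_time_eqI[OF t])
  have 2: "integral {0..2 * pi} (\<lambda>\<eta>. (norm (D_time a b c t \<eta>))\<^sup>2 * norm (D_ang (c t) \<eta>)) = kin 0 t"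
    unfolding kin_def by (simp only: D_time_c[OF t] D_ang_c[OF t] dot_square_norm)
  have "(\<lambda>\<eta>. D_ang (c t) \<eta> /\<^sub>R norm (D_ang (c t) \<eta>)) = (\<lambda>\<eta>. Tan (0, t, \<eta>))"
    by (simp only: D_ang_c[OF t] Tan_def)
  then have "D_ang (\<lambda>\<eta>. D_ang (c t) \<eta> /\<^sub>R norm (D_ang (c t) \<eta>)) \<theta> = Tan_h (0, t, \<theta>)"
    using vector_derivative_at[OF deriv_Tan_h[OF st]] by (simp add: D_ang_def[of "\<lambda>\<eta>. Tan (0, t, \<eta>)"])
  moreover have "D_ang (c t) = (\<lambda>\<theta>. Xh (0, t, \<theta>))" using D_ang_c[OF t] by blast
  then have "(D_ang (c t) has_vector_derivative Dh Xh (0, t, \<theta>)) (at \<theta>)"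
    using deriv_h[OF smooth_on_partial[OF smooth_X] st] by simp
  ultimately have 3: "\<i> * of_real (curvature (c t) \<theta>) * D_ang (c t) \<theta> = Tan_h (0, t, \<theta>)"
    using curvature_eqn[of "c t" "Dh Xh (0, t, \<theta>)" \<theta>] D_ang_c[OF t] Xh_nonzero[OF st] by simp
  have "(\<lambda>\<eta>. ((norm (D_time a b c t \<eta>))\<^sup>2 / norm (D_ang (c t) \<eta>)) *\<^sub>R D_ang (c t) \<eta>) = (\<lambda>\<eta>. Str (0, t, \<eta>))"
    by (simp add: D_time_c[OF t] D_ang_c[OF t] Str_def Tan_def dot_square_norm divide_inverse)
  then have 4: "D_ang (\<lambda>\<eta>. ((norm (D_time a b c t \<eta>))\<^sup>2 / norm (D_ang (c t) \<eta>)) *\<^sub>R D_ang (c t) \<eta>) \<theta>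
      = Str_h (0, t, \<theta>)"
    using vector_derivative_at[OF deriv_Str_h[OF st]] by (simp add: D_ang_def[of "\<lambda>\<eta>. Str (0, t, \<eta>)"])
  have "geodesic_defect \<phi> a b c t \<theta> = Mom_t (0, t, \<theta>) + (1 / 2) *
      (of_real (kin 0 t * deriv \<phi> (len 0 t)) * (\<i> * of_real (curvature (c t) \<theta>) * D_ang (c t) \<theta>)
        + of_real (\<phi> (len 0 t)) * Str_h (0, t, \<theta>))"
    unfolding geodesic_defect_def 1 2 4 len[OF t] by (simp add: algebra_simps)
  also have "\<dots> = - Grad (0, t, \<theta>)"
    unfolding 3 Grad_def by (simp add: scaleR_conv_of_real algebra_simps)
  finally show ?thesis .
qed


lemma geodesic_orthogonal:
  assumes "geodesic \<phi> a b c"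
  shows "integral J (\<lambda>t. integral {0..2 * pi} (\<lambda>\<theta>. geodesic_defect \<phi> a b c t \<theta> \<bullet> Xs (0, t, \<theta>))) = 0"
proof -
  have "((\<lambda>s. energy \<phi> a b (V s)) has_real_derivative 0) (at 0)"
    using assms \<epsilon> var unfolding geodesic_def by blast
  from DERIV_unique[OF first_variation this]
  have "integral J (\<lambda>t. integral {0..2 * pi} (\<lambda>\<theta>. Grad (0, t, \<theta>) \<bullet> Xs (0, t, \<theta>))) = 0" .
  moreover have "integral J (\<lambda>t. integral {0..2 * pi} (\<lambda>\<theta>. geodesic_defect \<phi> a b c t \<theta> \<bullet> Xs (0, t, \<theta>))) =
      integral J (\<lambda>t. - integral {0..2 * pi} (\<lambda>\<theta>. Grad (0, t, \<theta>) \<bullet> Xs (0, t, \<theta>)))"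
    by (rule integral_cong) (simp add: geodesic_defect_eq)
  ultimately show ?thesis by simp
qed

lemma critical_if_defect_zero:
  assumes "\<And>t \<theta>. t \<in> J \<Longrightarrow> geodesic_defect \<phi> a b c t \<theta> = 0"
  shows "((\<lambda>s. energy \<phi> a b (V s)) has_real_derivative 0) (at 0)"
proof -
  have "integral J (\<lambda>t. integral {0..2 * pi} (\<lambda>\<theta>. Grad (0, t, \<theta>) \<bullet> Xs (0, t, \<theta>))) = integral J (\<lambda>t. 0)"
  proof (rule integral_cong)
    fix t assume "t \<in> J"
    then have "Grad (0, t, \<theta>) = 0" for \<theta>
      using geodesic_defect_eq[of t \<theta>] assms[of t \<theta>] by simp
    then show "integral {0..2 * pi} (\<lambda>\<theta>. Grad (0, t, \<theta>) \<bullet> Xs (0, t, \<theta>)) = 0" by simp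
  qed
  then show ?thesis using first_variation by simp
qed

lemma geodesic_defect_continuous: "continuous_on (J \<times> UNIV) (\<lambda>p. geodesic_defect \<phi> a b c (fst p) (snd p))"
proof -
  have "continuous_on (J \<times> UNIV) (\<lambda>p. - Grad (0, fst p, snd p))"
    by (intro continuous_on_minus continuous_on_compose2[OF continuous_fields(7)])
       (use \<epsilon> in \<open>auto intro!: continuous_intros\<close>)
  then show ?thesis
    by (rule continuous_on_eq) (auto simp: geodesic_defect_eq)
qed

lemma geodesic_defect_periodic: "t \<in> J \<Longrightarrow> geodesic_defect \<phi> a b c t (\<theta> + 2 * pi) = geodesic_defect \<phi> a b c t \<theta>"
  using periodic_fields(4) zero_in_I unfolding periodic_def by (simp add: geodesic_defect_eq)

text \<open>\<open>|k\<^sub>\<theta>| / |c\<^sub>\<theta>|\<close> is bounded by compactness of \<open>{a..b} \<times> {0..2 * pi}\<close> and periodicity, so adding a small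
multiple of \<open>k\<close> cannot make the angular derivative vanish.\<close>
lemma perturbation:
  assumes path: "smooth_path a b c"
    and k: "trig_poly (\<lambda>x. k (fst (snd x)) (snd (snd x)))"
    and ends: "\<And>\<theta>. k a \<theta> = 0" "\<And>\<theta>. k b \<theta> = 0"
    and per: "\<And>t \<theta>. k t (\<theta> + 2 * pi) = k t \<theta>"
  shows "\<exists>\<delta>>0. fixed_endpoint_variation a b c \<delta> (\<lambda>s t \<theta>. c t \<theta> + of_real s * k t \<theta>)"
proof -
  define K where "K = (\<lambda>x :: real \<times> real \<times> real. k (fst (snd x)) (snd (snd x)))"
  have K: "smooth_on slab K"
    unfolding K_def slab_def by (rule trig_poly_smooth[OF thick_box[OF \<epsilon> ab] k])
  have K_per: "periodic K" by (simp add: periodic_def K_def per)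
  let ?r = "\<lambda>p. norm (Dh K (0, fst p, snd p)) / norm (Xh (0, fst p, snd p))"
  have "continuous_on (J \<times> {0..2 * pi}) ?r"
    by (intro continuous_intros continuous_partial[OF smooth_on_partial[OF K]]) (use \<epsilon> in auto)
  then have "bounded (?r ` (J \<times> {0..2 * pi}))"
    by (intro compact_imp_bounded compact_continuous_image compact_Times) auto
  then obtain M where M: "0 < M" "\<And>t \<theta>. t \<in> J \<Longrightarrow> \<theta> \<in> {0..2 * pi} \<Longrightarrow> norm (?r (t, \<theta>)) \<le> M"
    unfolding bounded_pos by blast
  have bound: "norm (Dh K (0, t, \<theta>)) \<le> M * norm (Xh (0, t, \<theta>))" if t: "t \<in> J" for t \<theta>
  proof -
    have "\<And>\<theta>. (Dh K (0, t, \<theta> + 2 * pi), Xh (0, t, \<theta> + 2 * pi)) = (Dh K (0, t, \<theta>), Xh (0, t, \<theta>))"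
      using periodic_partial(3)[OF K K_per] periodic_partial(3)[OF smooth_X periodic_X] t zero_in_I
      unfolding periodic_def by blast
    from periodic_representative[of "\<lambda>\<theta>. (Dh K (0, t, \<theta>), Xh (0, t, \<theta>))", OF this, of \<theta>]
    obtain \<eta> where "\<eta> \<in> {0..2 * pi}" "Dh K (0, t, \<theta>) = Dh K (0, t, \<eta>)" "Xh (0, t, \<theta>) = Xh (0, t, \<eta>)"
      by auto
    then show ?thesis
      using M(2)[OF t, of \<eta>] Xh_nonzero[OF zero_in_I t, of \<eta>] by (simp add: divide_le_eq)
  qed
  define \<delta> where "\<delta> = 1 / M"
  have \<delta>: "0 < \<delta>" using M by (simp add: \<delta>_def)
  let ?V = "\<lambda>s t \<theta>. c t \<theta> + of_real s * k t \<theta>"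
  let ?S = "{-\<delta><..<\<delta>} \<times> J \<times> (UNIV :: real set)"
  have smooth: "smooth_on ?S (\<lambda>(s, t, \<theta>). ?V s t \<theta>)"
  proof -
    have "smooth_on ?S (\<lambda>x. (\<lambda>(t, \<theta>). c t \<theta>) (snd x))"
      by (rule smooth_on_comp_snd[OF thick_box[OF \<delta> ab]]) (use path in \<open>simp add: smooth_path_def\<close>)
    moreover have "smooth_on ?S (\<lambda>x. of_real (fst x) * K x)"
      by (intro trig_poly_smooth[OF thick_box[OF \<delta> ab]] trig_poly.intros) (simp add: K_def k)
    ultimately have "smooth_on ?S (\<lambda>x. (\<lambda>(t, \<theta>). c t \<theta>) (snd x) + of_real (fst x) * K x)"
      by (rule smooth_on_add[OF thick_box[OF \<delta> ab]])
    then show ?thesis by (simp add: case_prod_unfold K_def)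
  qed
  have imm: "?V s t \<in> Imm" if s: "s \<in> {-\<delta><..<\<delta>}" and t: "t \<in> J" for s t
  proof -
    have "vector_derivative (?V s t) (at \<theta>) \<noteq> 0" for \<theta>
    proof -
      have "((\<lambda>\<theta>. X (0, t, \<theta>) + of_real s * K (0, t, \<theta>)) has_vector_derivative
          Xh (0, t, \<theta>) + of_real s * Dh K (0, t, \<theta>)) (at \<theta>)"
        by (intro has_vector_derivative_add has_vector_derivative_mult_right deriv_h smooth_X K zero_in_I t)
      then have vd: "vector_derivative (?V s t) (at \<theta>) = Xh (0, t, \<theta>) + of_real s * Dh K (0, t, \<theta>)"
        by (intro vector_derivative_at) (simp add: X_def K_def V_0[OF t])
      have less: "norm (of_real s * Dh K (0, t, \<theta>)) < norm (Xh (0, t, \<theta>))"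
      proof -
        have "norm (of_real s * Dh K (0, t, \<theta>)) \<le> \<bar>s\<bar> * (M * norm (Xh (0, t, \<theta>)))"
          using bound[OF t] by (simp add: norm_mult mult_left_mono)
        also have "\<dots> < \<delta> * (M * norm (Xh (0, t, \<theta>)))"
          using s M Xh_nonzero[OF zero_in_I t] by (intro mult_strict_right_mono) auto
        finally show ?thesis using M by (simp add: \<delta>_def)
      qed
      show ?thesis
      proof
        assume "vector_derivative (?V s t) (at \<theta>) = 0"
        then have "Xh (0, t, \<theta>) = - (of_real s * Dh K (0, t, \<theta>))"
          unfolding vd by (simp only: eq_neg_iff_add_eq_0)
        with less show False by simp
      qed
    qed
    moreover have "smooth_on UNIV (?V s t)"
      using smooth_on_slice[OF smooth s t] by simp
    moreover have "?V s t (\<theta> + 2 * pi) = ?V s t \<theta>" for \<theta>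
      using path t per unfolding smooth_path_def Imm_def by auto
    ultimately show ?thesis by (simp add: Imm_def)
  qed
  have "fixed_endpoint_variation a b c \<delta> ?V"
    unfolding fixed_endpoint_variation_def using smooth imm ends by auto
  with \<delta> show ?thesis by blast
qed

end

section \<open>Vanishing of the defect along geodesics\<close>

lemma constant_variation:
  assumes "smooth_on {0<..} \<phi>" "a < b" "smooth_path a b c"
  shows "curve_variation \<phi> a b 1 c (\<lambda>s. c)"
proof
  have "smooth_on ({-1<..<1::real} \<times> {a..b} \<times> UNIV) (\<lambda>x. (\<lambda>(t, \<theta>). c t \<theta>) (snd x))"
    by (rule smooth_on_comp_snd[OF thick_box]) (use assms in \<open>auto simp: smooth_path_def\<close>)
  then show "fixed_endpoint_variation a b c 1 (\<lambda>s. c)"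
    using assms(3) by (simp add: fixed_endpoint_variation_def smooth_path_def case_prod_unfold)
qed (use assms in auto)

text \<open>With the test vector \<open>e\<close> equal to the defect at \<open>(t0, \<theta>0)\<close> itself, orthogonality to the fields
\<open>(t - a) (b - t) p(t)\<^sup>n q(\<theta>)\<^sup>m e\<close> is exploited one variable at a time: first in \<open>n\<close>, which isolates the time
\<open>t0\<close> for each fixed \<open>m\<close>, then in \<open>m\<close>, which isolates the angle \<open>\<theta>0\<close>.\<close>
lemma geodesic_defect_zero_interior:
  assumes \<phi>: "smooth_on {0<..} \<phi>" and ab: "a < b" and path: "smooth_path a b c"
    and geo: "geodesic \<phi> a b c"
    and t0: "a < t0" "t0 < b" and \<theta>0: "0 < \<theta>0" "\<theta>0 < 2 * pi"
  shows "geodesic_defect \<phi> a b c t0 \<theta>0 = 0"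
proof -
  interpret base: curve_variation \<phi> a b 1 c "\<lambda>s. c"
    by (rule constant_variation[OF \<phi> ab path])
  define \<rho> where "\<rho> = geodesic_defect \<phi> a b c"
  define e where "e = \<rho> t0 \<theta>0"
  \<comment> \<open>Scaled by \<open>b - a\<close> so that \<open>p\<close> is nonnegative on all of \<open>{a..b}\<close>.\<close>
  define p where "p t = 1 - ((t - t0) / (b - a))\<^sup>2" for t
  define q where "q \<theta> = 1 + cos (\<theta> - \<theta>0)" for \<theta>
  have ort: "integral {a..b} (\<lambda>t. p t ^ n *
      ((t - a) * (b - t) * integral {0..2 * pi} (\<lambda>\<theta>. q \<theta> ^ m * (\<rho> t \<theta> \<bullet> e)))) = 0" for n m
  proof -
    define k where "k t \<theta> = complex_of_real ((t - a) * (b - t) * p t ^ n * q \<theta> ^ m) * e" for t \<theta>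
    have lin: "trig_poly (\<lambda>x. of_real (fst (snd x) - r))" for r
      using trig_poly.add[OF trig_poly.var_t trig_poly.const[of "- of_real r"]] by simp
    have neg: "trig_poly (\<lambda>x. f x - g x)" if "trig_poly f" "trig_poly g" for f g
      using trig_poly.add[OF that(1) trig_poly.mult[OF trig_poly.const[of "- 1"] that(2)]] by simp
    have quot: "trig_poly (\<lambda>x. of_real ((fst (snd x) - t0) / (b - a)))"
      using trig_poly.mult[OF lin[of t0] trig_poly.const[of "of_real (inverse (b - a))"]]
      by (simp only: of_real_mult divide_inverse)
    have "trig_poly (\<lambda>x. of_real (b - fst (snd x)))"
      using neg[OF trig_poly.const[of "of_real b"] trig_poly.var_t] by simp
    moreover have "trig_poly (\<lambda>x. of_real (p (fst (snd x))))"
      using neg[OF trig_poly.const[of 1] trig_poly_power[OF quot, of 2]]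
      by (simp only: p_def of_real_diff of_real_1 of_real_power)
    moreover have "trig_poly (\<lambda>x. of_real (q (snd (snd x))))"
      using trig_poly.add[OF trig_poly.const[of 1] trig_poly.cos[of \<theta>0]]
      by (simp only: q_def of_real_add of_real_1)
    ultimately have k: "trig_poly (\<lambda>x. k (fst (snd x)) (snd (snd x)))"
      unfolding k_def of_real_mult of_real_power
      by (intro trig_poly.mult trig_poly_power trig_poly.const lin)
    have "k a \<theta> = 0" "k b \<theta> = 0" "k t (\<theta> + 2 * pi) = k t \<theta>" for t \<theta>
      using cos_periodic[of "\<theta> - \<theta>0"] by (auto simp: k_def q_def algebra_simps)
    from base.perturbation[OF path k this] obtain \<delta>
      where \<delta>: "0 < \<delta>" "fixed_endpoint_variation a b c \<delta> (\<lambda>s t \<theta>. c t \<theta> + of_real s * k t \<theta>)"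
      by blast
    interpret W: curve_variation \<phi> a b \<delta> c "\<lambda>s t \<theta>. c t \<theta> + of_real s * k t \<theta>"
      by standard (use \<phi> ab \<delta> in auto)
    have Xs: "W.Xs (0, t, \<theta>) = k t \<theta>" if t: "t \<in> {a..b}" for t \<theta>
    proof -
      have "((\<lambda>s. c t \<theta> + of_real s * k t \<theta>) has_vector_derivative 0 + of_real 1 * k t \<theta>)
          (at 0 within {-\<delta><..<\<delta>})"
        by (intro has_vector_derivative_add has_vector_derivative_const has_vector_derivative_mult_left
              has_vector_derivative_of_real) (auto intro!: derivative_eq_intros)
      with W.deriv_s[OF W.smooth_X W.zero_in_I t, of \<theta>] show ?thesis
        using W.uniq_s[OF W.zero_in_I] by (simp add: W.X_def)
    qed
    have "integral {a..b} (\<lambda>t. integral {0..2 * pi} (\<lambda>\<theta>. \<rho> t \<theta> \<bullet> W.Xs (0, t, \<theta>))) = 0"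
      unfolding \<rho>_def by (rule W.geodesic_orthogonal[OF geo])
    also have "integral {a..b} (\<lambda>t. integral {0..2 * pi} (\<lambda>\<theta>. \<rho> t \<theta> \<bullet> W.Xs (0, t, \<theta>))) =
        integral {a..b} (\<lambda>t. p t ^ n * ((t - a) * (b - t) * integral {0..2 * pi} (\<lambda>\<theta>. q \<theta> ^ m * (\<rho> t \<theta> \<bullet> e))))"
    proof (rule integral_cong)
      fix t assume t: "t \<in> {a..b}"
      have "\<rho> t \<theta> \<bullet> k t \<theta> = p t ^ n * ((t - a) * (b - t)) * (q \<theta> ^ m * (\<rho> t \<theta> \<bullet> e))" for \<theta>
        unfolding k_def scaleR_conv_of_real[symmetric] by simp
      then show "integral {0..2 * pi} (\<lambda>\<theta>. \<rho> t \<theta> \<bullet> W.Xs (0, t, \<theta>)) =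
          p t ^ n * ((t - a) * (b - t) * integral {0..2 * pi} (\<lambda>\<theta>. q \<theta> ^ m * (\<rho> t \<theta> \<bullet> e)))"
        by (simp add: Xs[OF t] mult.assoc)
    qed
    finally show ?thesis .
  qed
  have cont: "continuous_on A (\<lambda>x. \<rho> (f x) (g x))"
    if "continuous_on A f" "continuous_on A g" "f ` A \<subseteq> {a..b}" for A f g
    using continuous_on_compose2[OF base.geodesic_defect_continuous, of A "\<lambda>x. (f x, g x)"] that
    unfolding \<rho>_def by (force intro: continuous_intros)
  have 1: "integral {0..2 * pi} (\<lambda>\<theta>. q \<theta> ^ m * (\<rho> t0 \<theta> \<bullet> e)) = 0" for m
  proof -
    have "continuous_on ({a..b} \<times> cbox 0 (2 * pi)) (\<lambda>(t, \<theta>). q \<theta> ^ m * (\<rho> t \<theta> \<bullet> e))"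
      unfolding case_prod_beta q_def by (intro continuous_intros cont) auto
    from integral_continuous_on_param[OF this]
    have c: "continuous_on {a..b} (\<lambda>t. (t - a) * (b - t) * integral {0..2 * pi} (\<lambda>\<theta>. q \<theta> ^ m * (\<rho> t \<theta> \<bullet> e)))"
      by (intro continuous_intros) simp
    have "(t0 - a) * (b - t0) * integral {0..2 * pi} (\<lambda>\<theta>. q \<theta> ^ m * (\<rho> t0 \<theta> \<bullet> e)) = 0"
    proof (rule concentrated_powers[OF t0 _ c _ _ ort])
      show "continuous_on {a..b} p" unfolding p_def by (intro continuous_intros) (use ab in auto)
      show "0 \<le> p t" if "t \<in> {a..b}" for t
      proof -
        have "\<bar>t - t0\<bar> \<le> b - a" using that t0 by auto
        then have "\<bar>(t - t0) / (b - a)\<bar> \<le> 1" using ab by (simp add: abs_divide)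
        then show ?thesis unfolding p_def by (simp add: abs_square_le_1)
      qed
      show "p t < p t0" if "t \<noteq> t0" for t
        unfolding p_def using that ab by simp
    qed
    then show ?thesis using t0 by simp
  qed
  have "\<rho> t0 \<theta>0 \<bullet> e = 0"
  proof (rule concentrated_powers[OF \<theta>0 _ _ _ _ 1])
    show "continuous_on {0..2 * pi} q" unfolding q_def by (intro continuous_intros)
    show "continuous_on {0..2 * pi} (\<lambda>\<theta>. \<rho> t0 \<theta> \<bullet> e)"
      by (intro continuous_intros cont) (use t0 in auto)
    show "0 \<le> q \<theta>" for \<theta> unfolding q_def using cos_ge_minus_one[of "\<theta> - \<theta>0"] by linarith
    show "q \<theta> < q \<theta>0" if "\<theta> \<in> {0..2 * pi}" "\<theta> \<noteq> \<theta>0" for \<theta>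
    proof -
      have "cos (\<theta> - \<theta>0) \<noteq> 1"
      proof
        assume "cos (\<theta> - \<theta>0) = 1"
        then obtain n :: int where n: "\<theta> - \<theta>0 = of_int n * 2 * pi" by (auto simp: cos_one_2pi_int)
        have "\<bar>\<theta> - \<theta>0\<bar> < 1 * (2 * pi)" using that \<theta>0 by auto
        then have "\<bar>of_int n :: real\<bar> < 1" unfolding n by (simp add: abs_mult)
        then have "n = 0" by linarith
        with n that show False by simp
      qed
      then show ?thesis unfolding q_def using cos_le_one[of "\<theta> - \<theta>0"] by (simp add: less_le)
    qed
  qed
  then show ?thesis by (simp add: e_def \<rho>_def)
qed

lemma geodesic_defect_zero:
  assumes \<phi>: "smooth_on {0<..} \<phi>" and ab: "a < b" and path: "smooth_path a b c"
    and geo: "geodesic \<phi> a b c" and t: "t \<in> {a..b}"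
  shows "geodesic_defect \<phi> a b c t \<theta> = 0"
proof -
  interpret base: curve_variation \<phi> a b 1 c "\<lambda>s. c"
    by (rule constant_variation[OF \<phi> ab path])
  have cl: "closure ({a<..<b} \<times> {0<..<2 * pi}) = {a..b} \<times> {0..2 * pi}"
    using ab by (simp add: closure_Times)
  obtain \<eta> where \<eta>: "\<eta> \<in> {0..2 * pi}" "geodesic_defect \<phi> a b c t \<theta> = geodesic_defect \<phi> a b c t \<eta>"
    using periodic_representative[of "geodesic_defect \<phi> a b c t" \<theta>] base.geodesic_defect_periodic[OF t] by blast
  have "(\<lambda>p. geodesic_defect \<phi> a b c (fst p) (snd p)) (t, \<eta>) = 0"
  proof (rule continuous_constant_on_closure[where S = "{a<..<b} \<times> {0<..<2 * pi}"])
    show "continuous_on (closure ({a<..<b} \<times> {0<..<2 * pi})) (\<lambda>p. geodesic_defect \<phi> a b c (fst p) (snd p))"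
      unfolding cl by (rule continuous_on_subset[OF base.geodesic_defect_continuous]) auto
    show "geodesic_defect \<phi> a b c (fst p) (snd p) = 0" if "p \<in> {a<..<b} \<times> {0<..<2 * pi}" for p
      using that by (auto intro: geodesic_defect_zero_interior[OF \<phi> ab path geo])
    show "(t, \<eta>) \<in> closure ({a<..<b} \<times> {0<..<2 * pi})" unfolding cl using t \<eta> by simp
  qed
  then show ?thesis using \<eta> by simp
qed

theorem mainTheorem5:
  fixes \<phi> :: "real \<Rightarrow> real" and a b :: real and c :: "real \<Rightarrow> real \<Rightarrow> complex"
  assumes "smooth_on {0<..} \<phi>" and "\<And>l. l > 0 \<Longrightarrow> \<phi> l > 0"
    and "a < b" and "smooth_path a b c"
  shows "geodesic \<phi> a b c \<longleftrightarrow>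
    (\<forall>t\<in>{a..b}. \<forall>\<theta>.
       D_time a b (\<lambda>\<tau> \<eta>. (\<phi> (curve_length (c \<tau>)) * norm (D_ang (c \<tau>) \<eta>)) *\<^sub>R D_time a b c \<tau> \<eta>) t \<theta>
       = - (1 / 2) *
         (of_real (integral {0..2 * pi} (\<lambda>\<eta>. (norm (D_time a b c t \<eta>))\<^sup>2 * norm (D_ang (c t) \<eta>)))
            * \<i> * of_real (deriv \<phi> (curve_length (c t)))
            * of_real (curvature (c t) \<theta>) * D_ang (c t) \<theta>
          + of_real (\<phi> (curve_length (c t)))
            * D_ang (\<lambda>\<eta>. ((norm (D_time a b c t \<eta>))\<^sup>2 / norm (D_ang (c t) \<eta>)) *\<^sub>R D_ang (c t) \<eta>) \<theta>))"
    (is "_ \<longleftrightarrow> (\<forall>t\<in>_. \<forall>\<theta>. ?L t \<theta> = ?R t \<theta>)")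
proof -
  have "?L t \<theta> = ?R t \<theta> \<longleftrightarrow> geodesic_defect \<phi> a b c t \<theta> = 0" for t \<theta>
    unfolding geodesic_defect_def mult_minus_left eq_neg_iff_add_eq_0 ..
  then have "(\<forall>t\<in>{a..b}. \<forall>\<theta>. ?L t \<theta> = ?R t \<theta>) \<longleftrightarrow> (\<forall>t\<in>{a..b}. \<forall>\<theta>. geodesic_defect \<phi> a b c t \<theta> = 0)"
    by simp
  also have "\<dots> \<longleftrightarrow> geodesic \<phi> a b c"
  proof
    assume *: "\<forall>t\<in>{a..b}. \<forall>\<theta>. geodesic_defect \<phi> a b c t \<theta> = 0"
    show "geodesic \<phi> a b c"
      unfolding geodesic_def
    proof (intro conjI allI impI)
      fix \<epsilon> V assume "0 < \<epsilon>" "fixed_endpoint_variation a b c \<epsilon> V"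
      then interpret curve_variation \<phi> a b \<epsilon> c V
        using assms by unfold_locales auto
      show "((\<lambda>s. energy \<phi> a b (V s)) has_real_derivative 0) (at 0)"
        by (rule critical_if_defect_zero) (use * in blast)
    qed (rule assms)
  qed (blast intro: geodesic_defect_zero[OF assms(1,3,4)])
  finally show ?thesis by (rule sym)
qed

end
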